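(* Let $Z(t)$, $t\in\mathbb{R}^d$, be a non-negative random field with sample paths almost surely in $D=D(\mathbb{R}^d,[0,\infty))$. Suppose that (a) $\mathbb{E}\{Z(t)\}=1$ for all $t\in\mathbb{R}^d$; (b) $\mathbb{E}\{\sup_{t\in[0,T]^d}Z(t)\}\in(0,\infty)$ for all $T>0$; (c) $\mathbb{E}\{Z(h)F(Z)\}=\mathbb{E}\{Z(0)F(B^hZ)\}$ for all $h\in\mathbb{R}^d$ and all measurable functionals $F:D\to[0,\infty)$ that are $0$-homogeneous (i.e. $F(cf)=F(f)$ for all $c>0$, $f\in D$); (d) $H_Z^0>0$. Then the formula $$H_Z^\delta=\mathbb{E}\Big\{Z(0)\,\frac{\sup_{t\in\delta\mathbb{Z}^d}Z(t)}{S_\eta(Z)}\Big\}\in[0,\infty)\qquad(\ast)$$ holds for $\delta=\eta=0$. Moreover, $(\ast)$ also holds for $\delta=0,\ \eta>0$, and for $\delta>0,\ \eta=k\delta$ with $k\in\mathbb{N}$, if in addition, for the $\delta,\eta$ under consideration, $$\{S_0(Z)<\infty\}\subset\{S_\eta(B^rZ)\in(0,\infty)\}\quad\text{almost surely, for all } r\in\delta\mathbb{Z}^d.$$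
   Context: Convention: $0\mathbb{Z}^d:=\mathbb{R}^d$. All random fields are defined on a complete probability space. For $\delta\ge0$, the Pickands constant is $H_Z^\delta=\lim_{T\to\infty}T^{-d}\,\mathbb{E}\{\sup_{t\in[0,T]^d\cap\delta\mathbb{Z}^d}Z(t)\}$. For $\eta\ge 0$ and a measurable $f:\mathbb{R}^d\to[0,\infty)$, $S_\eta(f)=\int_{\eta\mathbb{Z}^d}f(t)\,\lambda_\eta(dt)$, where $\lambda_0$ is Lebesgue measure on $\mathbb{R}^d$ and, for $\eta>0$, $\lambda_\eta$ is $\eta^d$ times the counting measure on $\eta\mathbb{Z}^d$. So $S_0(Z)=\int_{\mathbb{R}^d}Z(t)\,dt$ and $S_\eta(Z)=\eta^d\sum_{t\in\eta\mathbb{Z}^d}Z(t)$ for $\eta>0$. $B^h$ is the shift: $B^hZ(\cdot)=Z(\cdot-h)$, $h\in\mathbb{R}^d$. $D=D(\mathbb{R}^d,[0,\infty))$ is the space of generalised càdlàg functions $f:\mathbb{R}^d\to[0,\infty)$: for every $t\in\mathbb{R}^d$ and each of the $2^d$ orthants at $t$ (the sets of $s$ determined by choosing, for each coordinate $i$, either $s_i\ge t_i$ or $s_i<t_i$), the limit of $f(s)$ as $s\to t$ within the orthant exists, and it equals $f(t)$ for the orthant $\{s: s_i\ge t_i\ \forall i\}$. $D$ is equipped with the $\sigma$-field generated by the projections $\pi_t:f\mapsto f(t)$, $t$ in a dense subset of $\mathbb{R}^d$ (equivalently all $t \in \mathbb{R}^d$). Conventions for the quotient in $(\ast)$: $0/0$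 is interpreted as $0$, and the integrand is taken to be $0$ on the event $\{S_\eta(Z)=\infty\}$. For events, "$A\subset B$ almost surely" means $\mathbb{P}(A\setminus B)=0$. *)

theory Defs
  imports "HOL-Probability.Probability"
begin

text \<open>
  Suprema, expectations and integrals of non-negative quantities are taken in \<^typ>\<open>ennreal\<close>, so
  that they are meaningful without any integrability side condition. A random field is a function
  \<open>Z :: 'w \<Rightarrow> real ^ 'd \<Rightarrow> real\<close>, so that \<open>Z \<omega>\<close> is a sample path.
\<close>

definition grid :: "real \<Rightarrow> (real ^ 'd) set" where
  "grid \<delta> = (if \<delta> = 0 then UNIV else {t. \<forall>i. \<exists>n::int. t $ i = \<delta> * of_int n})"

definition cube :: "real \<Rightarrow> (real ^ 'd) set" where
  "cube T = {t. \<forall>i. t $ i \<in> {0..T}}"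

definition shift_field :: "real ^ 'd \<Rightarrow> (real ^ 'd \<Rightarrow> real) \<Rightarrow> real ^ 'd \<Rightarrow> real" where
  "shift_field h f = (\<lambda>t. f (t - h))"

definition orthant :: "'d set \<Rightarrow> real ^ 'd \<Rightarrow> (real ^ 'd) set" where
  "orthant I t = {s. \<forall>i. if i \<in> I then t $ i \<le> s $ i else s $ i < t $ i}"

definition cadlag :: "(real ^ 'd \<Rightarrow> real) set" where
  "cadlag = {f. (\<forall>t. 0 \<le> f t) \<and>
     (\<forall>t. (\<forall>I. \<exists>l. (f \<longlongrightarrow> l) (at t within orthant I t)) \<and>
          (f \<longlongrightarrow> f t) (at t within orthant UNIV t))}"

text \<open>The trace on \<^term>\<open>cadlag\<close> of the product \<open>\<sigma>\<close>-field is the one generated by the projections.\<close>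

definition cadlag_space :: "(real ^ 'd \<Rightarrow> real) measure" where
  "cadlag_space = restrict_space (Pi\<^sub>M UNIV (\<lambda>_. borel)) cadlag"

definition grid_measure :: "real \<Rightarrow> (real ^ 'd) measure" where
  "grid_measure \<eta> = (if \<eta> = 0 then lborel
     else scale_measure (ennreal (\<eta> ^ CARD('d))) (count_space (grid \<eta>)))"

definition S :: "real \<Rightarrow> (real ^ 'd \<Rightarrow> real) \<Rightarrow> ennreal" where
  "S \<eta> f = (\<integral>\<^sup>+ t. ennreal (f t) \<partial>grid_measure \<eta>)"

definition pickands_ratio ::
    "'w measure \<Rightarrow> ('w \<Rightarrow> real ^ 'd \<Rightarrow> real) \<Rightarrow> real \<Rightarrow> real \<Rightarrow> ennreal" where
  "pickands_ratio M Z \<delta> T =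
     (\<integral>\<^sup>+ \<omega>. (SUP t\<in>cube T \<inter> grid \<delta>. ennreal (Z \<omega> t)) \<partial>M) / ennreal (T ^ CARD('d))"

definition pickands_const ::
    "'w measure \<Rightarrow> ('w \<Rightarrow> real ^ 'd \<Rightarrow> real) \<Rightarrow> real \<Rightarrow> ennreal" where
  "pickands_const M Z \<delta> = Lim at_top (pickands_ratio M Z \<delta>)"

text \<open>
  In \<^typ>\<open>ennreal\<close> we have \<open>0 / 0 = 0\<close>, \<open>x / \<infinity> = 0\<close> for every \<open>x\<close> (including \<open>\<infinity>\<close>) and \<open>0 * \<infinity> = 0\<close>.
  Hence the integrand below vanishes where \<open>S \<eta> (Z \<omega>) = \<infinity>\<close>, and also where
  \<open>Z \<omega> 0 = 0\<close> and \<open>S \<eta> (Z \<omega>) = 0\<close>.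
\<close>

definition pickands_expectation ::
    "'w measure \<Rightarrow> ('w \<Rightarrow> real ^ 'd \<Rightarrow> real) \<Rightarrow> real \<Rightarrow> real \<Rightarrow> ennreal" where
  "pickands_expectation M Z \<delta> \<eta> =
     (\<integral>\<^sup>+ \<omega>. ennreal (Z \<omega> 0) * ((SUP t\<in>grid \<delta>. ennreal (Z \<omega> t)) / S \<eta> (Z \<omega>)) \<partial>M)"

text \<open>
  \<^const>\<open>Lim\<close> is unspecified for a divergent function, so the convergence is part of the formula.
\<close>

definition pickands_formula ::
    "'w measure \<Rightarrow> ('w \<Rightarrow> real ^ 'd \<Rightarrow> real) \<Rightarrow> real \<Rightarrow> real \<Rightarrow> bool" where
  "pickands_formula M Z \<delta> \<eta> \<longleftrightarrow>
     (pickands_ratio M Z \<delta> \<longlongrightarrow> pickands_const M Z \<delta>) at_top \<and>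
     pickands_const M Z \<delta> = pickands_expectation M Z \<delta> \<eta> \<and>
     pickands_expectation M Z \<delta> \<eta> < \<infinity>"

end

theory Submission
  imports Defs "HOL-Real_Asymp.Real_Asymp"
begin

text \<open>
  Everything happens under the law of the sample paths, on \<^const>\<open>cadlag_space\<close>, and the paths are
  split according to whether \<open>S 0 f\<close> is finite.

  On the dissipative part \<open>S 0 f < \<infinity>\<close> one writes \<open>sup\<^sub>K f = \<integral> f h \<cdot> (sup\<^sub>K f / S \<eta> f) \<lambda>\<^sub>\<eta>(dh)\<close>. The
  quotient is \<open>0\<close>-homogeneous and \<open>S \<eta>\<close> is invariant under shifts by the grid, so tilting gives
  \<open>E sup\<^sub>K f = \<integral> \<Phi> (K - h) \<lambda>\<^sub>\<eta>(dh)\<close> with \<open>\<Phi> A = E (f 0 \<cdot> sup\<^sub>A f / S \<eta> f)\<close>. For \<open>K = [0, T]\<^sup>d\<close> the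
  integrand is close to \<open>\<Phi> UNIV\<close> for \<open>h\<close> well inside \<open>K\<close>, and it has a small integral outside of a
  neighbourhood of \<open>K\<close>, because \<open>\<Phi>\<close> is subadditive and \<open>\<integral> \<Phi> (Q - h) \<lambda>\<^sub>\<eta>(dh)\<close> is finite for a unit
  cell \<open>Q\<close>.

  On the conservative part \<open>S 0 f = \<infinity>\<close> the supremum over \<open>K\<close> is at most \<open>c\<close> times the integral of \<open>f\<close>
  over a neighbourhood of \<open>K\<close>, plus the sum of those cell suprema that exceed \<open>c\<close> times the integral
  of \<open>f\<close> over a window of radius \<open>m\<close> around the cell. By stationarity of \<open>1\<close>-homogeneous functionals and
  dominated convergence, the latter is negligible as \<open>m \<rightarrow> \<infinity>\<close>; then \<open>c\<close> is arbitrary.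
\<close>

subsection \<open>Measurability on the path space\<close>

lemma space_cadlag_space: "space cadlag_space = (cadlag :: (real ^ 'd \<Rightarrow> real) set)"
  by (simp add: cadlag_space_def space_restrict_space space_PiM)

lemma cadlag_nonneg: "f \<in> cadlag \<Longrightarrow> 0 \<le> f t"
  by (simp add: cadlag_def)

lemma cadlag_right_continuous:
  "f \<in> cadlag \<Longrightarrow> (f \<longlongrightarrow> f t) (at t within orthant UNIV t)"
  by (simp add: cadlag_def)

lemma measurable_cadlag_spaceI:
  assumes "\<And>x. x \<in> space N \<Longrightarrow> g x \<in> cadlag"
    and "\<And>t. (\<lambda>x. g x t) \<in> borel_measurable N"
  shows "g \<in> N \<rightarrow>\<^sub>M cadlag_space"
  unfolding cadlag_space_def
proof (rule measurable_restrict_space2)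
  show "g \<in> space N \<rightarrow> cadlag" using assms(1) by auto
  show "g \<in> N \<rightarrow>\<^sub>M Pi\<^sub>M UNIV (\<lambda>_. borel)"
    using measurable_PiM_single'[of UNIV "\<lambda>t x. g x t" N "\<lambda>_. borel"] assms(2) by auto
qed

lemma measurable_eval: "(\<lambda>f. f t) \<in> borel_measurable cadlag_space"
  unfolding cadlag_space_def
  by (rule measurable_restrict_space1) (rule measurable_component_singleton, simp)

text \<open>Continuity of \<open>f\<close> at \<open>t\<close> holds along the closed upper orthant,
  and the filter \<open>at t\<close> leaves out \<open>t\<close> itself; hence the two conditions on
  \<open>s\<close>.\<close>

lemma right_approx:
  assumes f: "f \<in> cadlag" and lim: "s \<longlonglongrightarrow> t" and ge: "\<And>n. s n \<in> orthant UNIV t"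
    and "\<And>n. s n \<noteq> t"
  shows "(\<lambda>n. f (s n)) \<longlonglongrightarrow> f t"
proof (rule filterlim_compose[OF cadlag_right_continuous[OF f]])
  show "filterlim s (at t within orthant UNIV t) sequentially"
    unfolding filterlim_at using assms by auto
qed

text \<open>Rounding down and adding one lands strictly to the right of \<open>x\<close> even if
  \<open>2 ^ n * x\<close> is an integer, at the cost of at most one dyadic step.\<close>

lemma right_dyadic_bounds:
  fixes x :: real
  shows "x < (of_int \<lfloor>2 ^ n * x\<rfloor> + 1) / 2 ^ n" "(of_int \<lfloor>2 ^ n * x\<rfloor> + 1) / 2 ^ n \<le> x + (1/2) ^ n"
proof -
  have "2 ^ n * x < of_int \<lfloor>2 ^ n * x\<rfloor> + 1" by linarith
  then show "x < (of_int \<lfloor>2 ^ n * x\<rfloor> + 1) / 2 ^ n" by (simp add: field_simps)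
  have "of_int \<lfloor>2 ^ n * x\<rfloor> + 1 \<le> 2 ^ n * x + 1" by linarith
  then have "(of_int \<lfloor>2 ^ n * x\<rfloor> + 1) / 2 ^ n \<le> (2 ^ n * x + 1) / 2 ^ n"
    by (simp add: divide_right_mono)
  then show "(of_int \<lfloor>2 ^ n * x\<rfloor> + 1) / 2 ^ n \<le> x + (1/2) ^ n"
    by (simp add: add_divide_distrib power_one_over)
qed

text \<open>Joint measurability comes from the approximation of \<open>t\<close> by dyadic points whose coordinates
  are strictly larger: they stay in the orthant in which \<open>f\<close> is continuous.\<close>

lemma measurable_eval_pair:
  "(\<lambda>(f, t). f t) \<in> borel_measurable (cadlag_space \<Otimes>\<^sub>M (borel :: (real ^ 'd) measure))"
proof -
  define K where "K n t = (\<lambda>i. \<lfloor>2 ^ n * (t $ i)\<rfloor>)" for n and t :: "real ^ 'd"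
  define pt :: "nat \<Rightarrow> ('d \<Rightarrow> int) \<Rightarrow> real ^ 'd"
    where "pt n k = (\<chi> i. (of_int (k i) + 1) / 2 ^ n)" for n k
  have mK: "K n \<in> borel \<rightarrow>\<^sub>M count_space UNIV" for n
  proof -
    have "K n -` {k} \<inter> space borel \<in> sets borel" for k
    proof -
      have "K n -` {k} \<inter> space borel = (\<Inter>i. {t :: real ^ 'd. \<lfloor>2 ^ n * (t $ i)\<rfloor> = k i})"
        unfolding K_def by (auto simp: fun_eq_iff)
      also have "\<dots> \<in> sets borel"
      proof (rule sets.countable_INT)
        have "{t :: real ^ 'd. \<lfloor>2 ^ n * t $ i\<rfloor> = k i} \<in> sets borel" for i
        proof -
          have "{t :: real ^ 'd. \<lfloor>2 ^ n * t $ i\<rfloor> = k i}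
              = {t. of_int (k i) \<le> 2 ^ n * t $ i} \<inter> {t. 2 ^ n * t $ i < of_int (k i) + 1}"
            by (auto simp: floor_eq_iff)
          also have "\<dots> \<in> sets borel"
            by (intro sets.Int borel_closed borel_open closed_Collect_le open_Collect_less continuous_intros)
          finally show ?thesis .
        qed
        then show "range (\<lambda>i. {t :: real ^ 'd. \<lfloor>2 ^ n * t $ i\<rfloor> = k i}) \<subseteq> sets borel"
          by auto
      qed simp
      finally show ?thesis .
    qed
    then show ?thesis
      unfolding measurable_count_space_eq_countable[OF countableI_type] by blast
  qed
  have ptle: "t $ i < pt n (K n t) $ i" "pt n (K n t) $ i \<le> t $ i + (1/2) ^ n" for n t i
    unfolding pt_def K_def vec_lambda_beta by (rule right_dyadic_bounds)+
  \<comment> \<open>For a fixed integer vector \<open>k\<close> this is a projection, and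
    \<open>K n\<close> takes countably many values, so the measurable pieces can be glued.\<close>
  have m: "(\<lambda>p. fst p (pt n (K n (snd p)))) \<in> borel_measurable (cadlag_space \<Otimes>\<^sub>M borel)" for n
  proof (rule measurable_compose_countable[where g="\<lambda>p. K n (snd p)" and f="\<lambda>k p. fst p (pt n k)"])
    show "(\<lambda>p. fst p (pt n k)) \<in> borel_measurable (cadlag_space \<Otimes>\<^sub>M borel)" for k
      by (rule measurable_compose[OF measurable_fst measurable_eval])
    show "(\<lambda>p. K n (snd p)) \<in> cadlag_space \<Otimes>\<^sub>M borel \<rightarrow>\<^sub>M count_space UNIV"
      by (rule measurable_compose[OF measurable_snd mK])
  qed
  show ?thesis
  proof (rule borel_measurable_LIMSEQ_metric[OF m])
    fix p :: "(real ^ 'd \<Rightarrow> real) \<times> (real ^ 'd)"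
    assume "p \<in> space (cadlag_space \<Otimes>\<^sub>M borel)"
    then obtain f t where p: "p = (f, t)" and f: "f \<in> cadlag"
      by (auto simp: space_pair_measure space_cadlag_space)
    have "(\<lambda>n. pt n (K n t)) \<longlonglongrightarrow> t"
    proof (rule vec_tendstoI)
      fix i
      have lim: "(\<lambda>n. t $ i + (1/2) ^ n) \<longlonglongrightarrow> t $ i + 0"
        by (intro tendsto_intros LIMSEQ_power_zero) auto
      show "(\<lambda>n. pt n (K n t) $ i) \<longlonglongrightarrow> t $ i"
      proof (rule tendsto_sandwich[OF _ _ tendsto_const])
        show "\<forall>\<^sub>F n in sequentially. t $ i \<le> pt n (K n t) $ i"
          using ptle(1) by (intro always_eventually allI less_imp_le)
        show "\<forall>\<^sub>F n in sequentially. pt n (K n t) $ i \<le> t $ i + (1/2) ^ n"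
          using ptle(2) by (intro always_eventually allI)
        show "(\<lambda>n. t $ i + (1/2) ^ n) \<longlonglongrightarrow> t $ i"
          using lim by simp
      qed
    qed
    moreover have "pt n (K n t) \<in> orthant UNIV t" for n
      using ptle by (auto simp: orthant_def less_imp_le)
    moreover have "pt n (K n t) \<noteq> t" for n
      using ptle(1)[of t undefined n] by auto
    ultimately have "(\<lambda>n. f (pt n (K n t))) \<longlonglongrightarrow> f t"
      by (rule right_approx[OF f])
    then show "(\<lambda>n. fst p (pt n (K n (snd p)))) \<longlonglongrightarrow> (case p of (f, t) \<Rightarrow> f t)"
      by (simp add: p)
  qed
qed

lemma measurable_eval_compose [measurable (raw)]:
  assumes "g \<in> N \<rightarrow>\<^sub>M cadlag_space" and "h \<in> N \<rightarrow>\<^sub>M borel"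
  shows "(\<lambda>x. g x (h x)) \<in> borel_measurable N"
  using measurable_compose[OF measurable_Pair[OF assms] measurable_eval_pair] by simp

text \<open>Translation by \<open>- h\<close> carries each orthant at \<open>t\<close> onto the
  orthant of the same type at \<open>t - h\<close>, so every directional limit is
  transported.\<close>

lemma shift_field_cadlag:
  assumes f: "f \<in> cadlag"
  shows "shift_field h f \<in> cadlag"
proof -
  have *: "(shift_field h f \<longlongrightarrow> l) (at t within orthant I t)"
    if "(f \<longlongrightarrow> l) (at (t - h) within orthant I (t - h))" for l t I
    unfolding shift_field_def
  proof (rule filterlim_compose[OF that])
    show "filterlim (\<lambda>s. s - h) (at (t - h) within orthant I (t - h)) (at t within orthant I t)"
      unfolding filterlim_at
    proof (intro conjI)
      show "((\<lambda>s. s - h) \<longlongrightarrow> t - h) (at t within orthant I t)"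
        by (intro tendsto_intros)
      show "\<forall>\<^sub>F s in at t within orthant I t. s - h \<in> orthant I (t - h) \<and> s - h \<noteq> t - h"
        unfolding eventually_at_filter by (auto simp: orthant_def)
    qed
  qed
  have "\<exists>l. (shift_field h f \<longlongrightarrow> l) (at t within orthant I t)" for t I
  proof -
    obtain l where "(f \<longlongrightarrow> l) (at (t - h) within orthant I (t - h))"
      using f unfolding cadlag_def by blast
    from *[OF this] show ?thesis by blast
  qed
  moreover have "(shift_field h f \<longlongrightarrow> shift_field h f t) (at t within orthant UNIV t)" for t
    using *[OF cadlag_right_continuous[OF f]] by (simp add: shift_field_def)
  ultimately show ?thesis
    using cadlag_nonneg[OF f] unfolding cadlag_def by (auto simp: shift_field_def)
qed

text \<open>The zero path serves as the substitute on the exceptional null set when the field is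
  replaced by one with all paths in \<open>cadlag\<close>.\<close>

lemma zero_cadlag: "(\<lambda>_. 0) \<in> cadlag"
  unfolding cadlag_def by auto

lemma measurable_shift_field [measurable (raw)]:
  fixes h :: "'b \<Rightarrow> real ^ 'd"
  assumes g: "g \<in> N \<rightarrow>\<^sub>M cadlag_space" and h: "h \<in> N \<rightarrow>\<^sub>M borel"
  shows "(\<lambda>x. shift_field (h x) (g x)) \<in> N \<rightarrow>\<^sub>M cadlag_space"
proof (rule measurable_cadlag_spaceI)
  show "shift_field (h x) (g x) \<in> cadlag" if "x \<in> space N" for x
    using measurable_space[OF g that] by (simp add: space_cadlag_space shift_field_cadlag)
  show "(\<lambda>x. shift_field (h x) (g x) t) \<in> borel_measurable N" for t
    unfolding shift_field_def using h by (intro measurable_eval_compose[OF g]) simp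
qed

subsection \<open>Suprema\<close>

definition sup_on :: "(real ^ 'd) set \<Rightarrow> (real ^ 'd \<Rightarrow> real) \<Rightarrow> ennreal" where
  "sup_on A f = (SUP t\<in>A. ennreal (f t))"

definition sqbox :: "real \<Rightarrow> real \<Rightarrow> (real ^ 'd) set" where
  "sqbox l u = {t. \<forall>i. l \<le> t $ i \<and> t $ i \<le> u}"

lemma cube_sqbox: "cube T = sqbox 0 T"
  by (auto simp: cube_def sqbox_def)

lemma sqbox_cbox: "sqbox l u = cbox (vec l) (vec u)"
  by (auto simp: sqbox_def mem_box_cart)

lemma sup_on_mono: "A \<subseteq> B \<Longrightarrow> sup_on A f \<le> sup_on B f"
  unfolding sup_on_def by (rule SUP_subset_mono) auto

lemma sup_on_upper: "t \<in> A \<Longrightarrow> ennreal (f t) \<le> sup_on A f"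
  unfolding sup_on_def by (rule SUP_upper)

lemma sup_on_scale:
  assumes "0 \<le> u" "f \<in> cadlag"
  shows "sup_on A (\<lambda>t. u * f t) = ennreal u * sup_on A f"
  unfolding sup_on_def using assms by (simp add: ennreal_mult cadlag_nonneg SUP_mult_left_ennreal)

lemma sup_on_shift: "sup_on A (shift_field h f) = sup_on {t. t + h \<in> A} f"
proof -
  have "(\<lambda>t. t - h) ` A = {t. t + h \<in> A}"
    by (force simp: image_iff)
  then show ?thesis
    unfolding sup_on_def shift_field_def by (simp add: image_image flip: \<open>_ = {t. t + h \<in> A}\<close>)
qed

text \<open>Each \<open>f t\<close> is approximated by values at points weakly to the right of
  \<open>t\<close> with rational coordinates. Where a coordinate of \<open>t\<close> equals
  \<open>u\<close> there is no room to the right inside the box, so that coordinate is kept.\<close>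

lemma sup_on_sqbox_countable:
  fixes f :: "real ^ 'd \<Rightarrow> real"
  assumes f: "f \<in> cadlag"
  shows "sup_on (sqbox l u) f = sup_on {t \<in> sqbox l u. \<forall>i. t $ i \<in> \<rat> \<or> t $ i = u} f"
    (is "_ = sup_on ?C f")
proof (rule antisym)
  show "sup_on ?C f \<le> sup_on (sqbox l u) f" by (rule sup_on_mono) auto
  show "sup_on (sqbox l u) f \<le> sup_on ?C f"
    unfolding sup_on_def[of "sqbox l u"]
  proof (rule SUP_least)
    fix t :: "real ^ 'd" assume t: "t \<in> sqbox l u"
    show "ennreal (f t) \<le> sup_on ?C f"
    proof (rule dense_le)
      fix y assume y: "y < ennreal (f t)"
      have "((\<lambda>s. ennreal (f s)) \<longlongrightarrow> ennreal (f t)) (at t within orthant UNIV t)"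
        by (intro tendsto_ennrealI cadlag_right_continuous f)
      from order_tendstoD(1)[OF this y] obtain e where e: "e > 0"
        and eq: "\<And>s. s \<in> orthant UNIV t \<Longrightarrow> s \<noteq> t \<Longrightarrow> dist s t < e \<Longrightarrow> y < ennreal (f s)"
        unfolding eventually_at by metis
      \<comment> \<open>The Euclidean distance is at most the sum of the coordinate distances, so
        each coordinate gets an equal share of \<open>e\<close>.\<close>
      define e' where "e' = e / (CARD('d))"
      have e': "e' > 0" using e by (simp add: e'_def)
      have "\<exists>r. (r \<in> \<rat> \<or> r = u) \<and> t $ i \<le> r \<and> r \<le> u \<and> r < t $ i + e'" for i
      proof (cases "t $ i = u")
        case True then show ?thesis using e' by auto
      next
        case False
        then have "t $ i < min u (t $ i + e')" using t e' by (auto simp: sqbox_def less_le)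
        from Rats_dense_in_real[OF this] show ?thesis by (auto intro: less_imp_le)
      qed
      then obtain r where r: "\<And>i. r i \<in> \<rat> \<or> r i = u" "\<And>i. t $ i \<le> r i" "\<And>i. r i \<le> u"
        "\<And>i. r i < t $ i + e'" by metis
      define s where "s = (\<chi> i. r i)"
      have "dist s t \<le> (\<Sum>i\<in>UNIV. \<bar>(s - t) $ i\<bar>)"
        unfolding dist_norm by (rule norm_le_l1_cart)
      also have "\<dots> < (\<Sum>i\<in>(UNIV :: 'd set). e')"
      proof (rule sum_strict_mono)
        fix i show "\<bar>(s - t) $ i\<bar> < e'" using r(2)[of i] r(4)[of i] by (simp add: s_def)
      qed auto
      also have "\<dots> = e" by (simp add: e'_def)
      finally have "dist s t < e" .
      moreover have "s \<in> orthant UNIV t" using r by (auto simp: orthant_def s_def)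
      ultimately have "y < ennreal (f s)" using eq y by (cases "s = t") auto
      moreover have "s \<in> ?C"
        using r t order_trans[OF _ r(2), of l] by (simp add: sqbox_def s_def)
      ultimately show "y \<le> sup_on ?C f" using sup_on_upper[of s ?C f] by auto
    qed
  qed
qed

lemma countable_vec_components:
  assumes "countable A"
  shows "countable {t :: real ^ 'd. \<forall>i. t $ i \<in> A}"
proof -
  have "{t :: real ^ 'd. \<forall>i. t $ i \<in> A} \<subseteq> vec_lambda ` (PiE UNIV (\<lambda>_. A))"
  proof
    fix t :: "real ^ 'd" assume "t \<in> {t. \<forall>i. t $ i \<in> A}"
    then have "vec_nth t \<in> PiE UNIV (\<lambda>_. A)" by auto
    then show "t \<in> vec_lambda ` (PiE UNIV (\<lambda>_. A))"
      by (metis image_eqI vec_nth_inverse)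
  qed
  moreover have "countable (PiE (UNIV :: 'd set) (\<lambda>_. A))"
    by (intro countable_PiE) (use assms in auto)
  ultimately show ?thesis by (meson countable_image countable_subset)
qed

lemma measurable_sup_on_countable:
  assumes "countable A"
  shows "sup_on A \<in> borel_measurable cadlag_space"
  unfolding sup_on_def[abs_def] using measurable_eval
  by (intro borel_measurable_SUP assms) auto

lemma measurable_sup_on_sqbox: "sup_on (sqbox l u :: (real ^ 'd) set) \<in> borel_measurable cadlag_space"
proof -
  have "countable {t \<in> (sqbox l u :: (real ^ 'd) set). \<forall>i. t $ i \<in> \<rat> \<or> t $ i = u}"
    by (rule countable_subset[OF _ countable_vec_components[of "insert u \<rat>"]])
      (auto simp: countable_rat)
  then show ?thesis
    by (subst measurable_cong[OF sup_on_sqbox_countable])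
      (simp_all add: space_cadlag_space measurable_sup_on_countable)
qed

lemma countable_grid: "\<delta> \<noteq> 0 \<Longrightarrow> countable (grid \<delta> :: (real ^ 'd) set)"
  by (rule countable_subset[OF _ countable_vec_components[of "range (\<lambda>n::int. \<delta> * of_int n)"]])
    (auto simp: grid_def image_iff)

lemma measurable_sup_on_sqbox_grid:
  "sup_on (sqbox l u \<inter> grid \<delta> :: (real ^ 'd) set) \<in> borel_measurable cadlag_space"
proof (cases "\<delta> = 0")
  case True
  then show ?thesis by (simp add: grid_def measurable_sup_on_sqbox)
next
  case False
  then show ?thesis
    by (intro measurable_sup_on_countable countable_subset[OF _ countable_grid[OF False]]) auto
qed

lemma UN_sqbox: "(\<Union>m::nat. sqbox (- real m) (real m)) = (UNIV :: (real ^ 'd) set)"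
proof (rule UNIV_eq_I[symmetric])
  fix t :: "real ^ 'd"
  obtain m :: nat where m: "norm t \<le> real m" using real_arch_simple by blast
  have "\<bar>t $ i\<bar> \<le> real m" for i using component_le_norm_cart[of t i] m by linarith
  then have "t \<in> sqbox (- real m) (real m)" by (auto simp: sqbox_def abs_le_iff minus_le_iff)
  then show "t \<in> (\<Union>m::nat. sqbox (- real m) (real m))" by blast
qed

text \<open>Measurability is known on boxes, also for the uncountable grid at
  \<open>\<delta> = 0\<close>; this exhaustion carries it over to the whole grid.\<close>

lemma sup_on_grid_SUP:
  fixes f :: "real ^ 'd \<Rightarrow> real"
  shows "sup_on (grid \<delta>) f = (SUP m::nat. sup_on (sqbox (- real m) (real m) \<inter> grid \<delta>) f)"
proof -
  have "(grid \<delta> :: (real ^ 'd) set) = (\<Union>m::nat. sqbox (- real m) (real m) \<inter> grid \<delta>)"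
    using UN_sqbox by blast
  from arg_cong[OF this, of "\<lambda>A. sup_on A f"] show ?thesis unfolding sup_on_def SUP_UNION .
qed

lemma measurable_sup_on_grid: "sup_on (grid \<delta> :: (real ^ 'd) set) \<in> borel_measurable cadlag_space"
proof -
  have "sup_on (grid \<delta> :: (real ^ 'd) set) = (\<lambda>f. SUP m::nat. sup_on (sqbox (- real m) (real m) \<inter> grid \<delta>) f)"
    using sup_on_grid_SUP by blast
  also have "\<dots> \<in> borel_measurable cadlag_space"
    by (intro borel_measurable_SUP measurable_sup_on_sqbox_grid) auto
  finally show ?thesis .
qed

subsection \<open>The measures on the grids\<close>

lemma space_grid_measure: "space (grid_measure \<eta>) = grid \<eta>"
  by (simp add: grid_measure_def grid_def space_scale_measure)

lemma zero_in_grid: "0 \<in> grid \<eta>"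
  by (auto simp: grid_def intro: exI[of _ 0])

lemma grid_add: "s \<in> grid \<eta> \<Longrightarrow> t \<in> grid \<eta> \<Longrightarrow> s + t \<in> grid \<eta>"
  unfolding grid_def by (auto split: if_splits simp: distrib_left[symmetric]) (metis distrib_left of_int_add)

lemma grid_minus: "t \<in> grid \<eta> \<Longrightarrow> - t \<in> grid \<eta>"
  unfolding grid_def by (auto split: if_splits) (metis mult_minus_right of_int_minus)

lemma grid_diff: "s \<in> grid \<eta> \<Longrightarrow> t \<in> grid \<eta> \<Longrightarrow> s - t \<in> grid \<eta>"
  using grid_add[of s \<eta> "- t"] grid_minus[of t \<eta>] by simp

lemma grid_add_iff: "h \<in> grid \<delta> \<Longrightarrow> t + h \<in> grid \<delta> \<longleftrightarrow> t \<in> grid \<delta>"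
  by (metis add_diff_cancel_right' grid_add grid_diff)

lemma grid_multiple:
  assumes k: "k \<ge> 1"
  shows "grid (real k * \<delta>) \<subseteq> grid \<delta>"
proof (cases "\<delta> = 0")
  case False
  show ?thesis
  proof
    fix t assume t: "t \<in> grid (real k * \<delta>)"
    have "\<exists>n::int. t $ i = \<delta> * of_int n" for i
    proof -
      obtain n :: int where "t $ i = real k * \<delta> * of_int n"
        using t k False by (auto simp: grid_def)
      then show ?thesis by (intro exI[of _ "int k * n"]) simp
    qed
    then show "t \<in> grid \<delta>" by (simp add: grid_def)
  qed
qed (simp add: grid_def)

lemma measurable_ident_grid_measure: "(\<lambda>t. t) \<in> grid_measure \<eta> \<rightarrow>\<^sub>M borel"
  by (auto simp: grid_measure_def measurable_def sets_scale_measure space_scale_measure)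

lemma measurable_grid_measureI: "g \<in> borel_measurable borel \<Longrightarrow> g \<in> borel_measurable (grid_measure \<eta>)"
  using measurable_compose[OF measurable_ident_grid_measure] by blast

text \<open>For \<open>\<eta> \<noteq> 0\<close> the underlying space of the measure is only the
  grid, so Borel sets are traced on it.\<close>

lemma sets_grid_measure_Int:
  "(A :: (real ^ 'd) set) \<in> sets borel \<Longrightarrow> A \<inter> grid \<eta> \<in> sets (grid_measure \<eta>)"
  using measurable_sets[OF measurable_ident_grid_measure, of A \<eta>]
  by (simp add: space_grid_measure vimage_def Int_def)

lemma sigma_finite_grid_measure:
  shows "sigma_finite_measure (grid_measure \<eta> :: (real ^ 'd) measure)"
proof (cases "\<eta> = 0")
  case True
  then show ?thesis by (simp add: grid_measure_def sigma_finite_lborel)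
next
  case False
  show ?thesis
  proof
    let ?A = "(\<lambda>t. {t}) ` (grid \<eta> :: (real ^ 'd) set)"
    show "\<exists>A. countable A \<and> A \<subseteq> sets (grid_measure \<eta> :: (real ^ 'd) measure) \<and>
        \<Union> A = space (grid_measure \<eta> :: (real ^ 'd) measure) \<and>
        (\<forall>a\<in>A. emeasure (grid_measure \<eta> :: (real ^ 'd) measure) a \<noteq> \<infinity>)"
      using False countable_grid[OF False]
      by (intro exI[of _ ?A])
        (auto simp: space_grid_measure, auto simp: grid_measure_def ennreal_mult_eq_top_iff)
  qed
qed

lemma nn_integral_grid_measure:
  assumes "\<eta> \<noteq> 0"
  shows "(\<integral>\<^sup>+ t. g t \<partial>grid_measure \<eta>) =
    ennreal (\<eta> ^ CARD('d)) * (\<integral>\<^sup>+ t. g (t :: real ^ 'd) \<partial>count_space (grid \<eta>))"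
  using assms by (simp add: grid_measure_def nn_integral_scale_measure)

text \<open>Lebesgue measure is translation invariant, and a translation by a grid vector permutes
  the grid.\<close>

lemma nn_integral_grid_measure_shift:
  fixes g :: "real ^ 'd \<Rightarrow> ennreal"
  assumes u: "u \<in> grid \<eta>" and g: "g \<in> borel_measurable borel"
  shows "(\<integral>\<^sup>+ t. g (t + u) \<partial>grid_measure \<eta>) = (\<integral>\<^sup>+ t. g t \<partial>grid_measure \<eta>)"
proof (cases "\<eta> = 0")
  case True
  have "(\<integral>\<^sup>+ t. g t \<partial>lborel) = (\<integral>\<^sup>+ t. g t \<partial>distr lborel borel ((+) u))"
    by (simp add: lborel_distr_plus)
  also have "\<dots> = (\<integral>\<^sup>+ t. g (u + t) \<partial>lborel)"
    by (rule nn_integral_distr) (use g in auto)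
  finally show ?thesis using True by (simp add: grid_measure_def add.commute)
next
  case False
  have "bij_betw (\<lambda>t. t + u) (grid \<eta>) (grid \<eta>)"
    by (rule bij_betwI[of _ _ _ "\<lambda>t. t - u"]) (auto intro: grid_add grid_diff u)
  from nn_integral_bij_count_space[OF this, of g] show ?thesis
    by (simp add: nn_integral_grid_measure[OF False])
qed

lemma cadlag_borel_measurable: "f \<in> cadlag \<Longrightarrow> f \<in> borel_measurable borel"
  using measurable_eval_compose[of "\<lambda>_. f" borel "\<lambda>t. t"] by (simp add: space_cadlag_space)

lemma S_scale:
  assumes "f \<in> cadlag" "0 \<le> u"
  shows "S \<eta> (\<lambda>t. u * f t) = ennreal u * S \<eta> f"
proof -
  have "f \<in> borel_measurable borel" by (rule cadlag_borel_measurable) fact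
  then have "(\<lambda>t. ennreal (f t)) \<in> borel_measurable (grid_measure \<eta>)"
    by (intro measurable_grid_measureI) simp
  then show ?thesis
    unfolding S_def using assms by (simp add: ennreal_mult cadlag_nonneg nn_integral_cmult)
qed

lemma S_shift_field:
  assumes f: "f \<in> cadlag" and h: "h \<in> grid \<eta>"
  shows "S \<eta> (shift_field h f) = S \<eta> f"
  using nn_integral_grid_measure_shift[OF grid_minus[OF h], of "\<lambda>t. ennreal (f t)"]
    cadlag_borel_measurable[OF f] by (simp add: S_def shift_field_def)

lemma measurable_S: "S \<eta> \<in> borel_measurable cadlag_space"
proof -
  interpret sigma_finite_measure "grid_measure \<eta> :: (real ^ 'd) measure"
    by (rule sigma_finite_grid_measure)
  note measurable_ident_grid_measure [measurable]
  have "(\<lambda>p. ennreal (fst p (snd p))) \<in>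
      borel_measurable (cadlag_space \<Otimes>\<^sub>M (grid_measure \<eta> :: (real ^ 'd) measure))"
    by measurable
  then show ?thesis
    unfolding S_def[abs_def] by (intro borel_measurable_nn_integral) (simp add: case_prod_beta')
qed

section \<open>Lattice point counts, volumes of boxes and coverings by cells\<close>

lemma card_lattice_interval:
  fixes l u \<eta> :: real
  assumes "\<eta> > 0" "l \<le> u"
  shows "finite {n::int. l \<le> \<eta> * of_int n \<and> \<eta> * of_int n \<le> u}"
    and "real (card {n::int. l \<le> \<eta> * of_int n \<and> \<eta> * of_int n \<le> u}) \<le> (u - l) / \<eta> + 1"
    and "(u - l) / \<eta> - 1 \<le> real (card {n::int. l \<le> \<eta> * of_int n \<and> \<eta> * of_int n \<le> u})"
proof -
  have eq: "{n::int. l \<le> \<eta> * of_int n \<and> \<eta> * of_int n \<le> u} = {\<lceil>l / \<eta>\<rceil>..\<lfloor>u / \<eta>\<rfloor>}"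
    using assms by (auto simp: ceiling_le_iff le_floor_iff field_simps)
  show "finite {n::int. l \<le> \<eta> * of_int n \<and> \<eta> * of_int n \<le> u}" unfolding eq by simp
  have "l / \<eta> \<le> u / \<eta>" using assms by (simp add: divide_right_mono)
  \<comment> \<open>The interval may contain no integer, but the difference of the roundings is then
    exactly \<open>-1\<close>, so the truncation at zero in \<open>card\<close> loses
    nothing.\<close>
  then have "\<lfloor>u / \<eta>\<rfloor> - \<lceil>l / \<eta>\<rceil> + 1 \<ge> 0" by linarith
  then have "real (card {\<lceil>l / \<eta>\<rceil>..\<lfloor>u / \<eta>\<rfloor>}) = of_int \<lfloor>u / \<eta>\<rfloor> - of_int \<lceil>l / \<eta>\<rceil> + 1"
    by (simp add: algebra_simps)
  then show "real (card {n::int. l \<le> \<eta> * of_int n \<and> \<eta> * of_int n \<le> u}) \<le> (u - l) / \<eta> + 1"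
    and "(u - l) / \<eta> - 1 \<le> real (card {n::int. l \<le> \<eta> * of_int n \<and> \<eta> * of_int n \<le> u})"
    unfolding eq diff_divide_distrib by linarith+
qed

text \<open>A grid point of the box is an independent choice of an admissible integer in each
  coordinate, so the one-dimensional count is raised to the power of the dimension.\<close>

lemma card_sqbox_grid:
  fixes l u \<eta> :: real
  assumes "\<eta> > 0" "l \<le> u"
  defines "A \<equiv> sqbox l u \<inter> (grid \<eta> :: (real ^ 'd) set)"
  shows "finite A"
    and "real (card A) \<le> ((u - l) / \<eta> + 1) ^ CARD('d)"
    and "0 \<le> (u - l) / \<eta> - 1 \<Longrightarrow> ((u - l) / \<eta> - 1) ^ CARD('d) \<le> real (card A)"
proof -
  define I where "I = {n::int. l \<le> \<eta> * of_int n \<and> \<eta> * of_int n \<le> u}"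
  have I: "finite I" "real (card I) \<le> (u - l) / \<eta> + 1" "(u - l) / \<eta> - 1 \<le> real (card I)"
    using card_lattice_interval[OF assms(1,2)] by (simp_all add: I_def)
  have "bij_betw (\<lambda>n. \<chi> i. \<eta> * of_int (n i)) (PiE (UNIV :: 'd set) (\<lambda>_. I)) A"
    unfolding bij_betw_def
  proof
    show "inj_on (\<lambda>n. (\<chi> i. \<eta> * of_int (n i)) :: real ^ 'd) (PiE (UNIV :: 'd set) (\<lambda>_. I))"
      using assms(1) by (auto simp: inj_on_def vec_eq_iff fun_eq_iff)
    show "(\<lambda>n. \<chi> i. \<eta> * of_int (n i)) ` (PiE (UNIV :: 'd set) (\<lambda>_. I)) = A" (is "?L = _")
    proof
      show "?L \<subseteq> A" using assms(1) by (auto simp: A_def sqbox_def grid_def I_def)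
      show "A \<subseteq> ?L"
      proof
        fix t assume t: "t \<in> A"
        then have "\<forall>i. \<exists>n::int. t $ i = \<eta> * of_int n" using assms(1) by (auto simp: A_def grid_def)
        then obtain n :: "'d \<Rightarrow> int" where n: "\<And>i. t $ i = \<eta> * of_int (n i)" by metis
        then have "n i \<in> I" for i using t by (auto simp: A_def sqbox_def I_def)
        then have "n \<in> PiE UNIV (\<lambda>_. I)" by auto
        moreover have "t = (\<chi> i. \<eta> * of_int (n i))" using n by (simp add: vec_eq_iff)
        ultimately show "t \<in> ?L" by blast
      qed
    qed
  qed
  from bij_betw_finite[OF this] bij_betw_same_card[OF this]
  have fin: "finite A" and c: "card A = card I ^ CARD('d)"
    using I(1) by (simp_all add: finite_PiE card_PiE)
  show "finite A" by fact
  show "real (card A) \<le> ((u - l) / \<eta> + 1) ^ CARD('d)"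
    unfolding c of_nat_power by (rule power_mono[OF I(2)]) simp
  show "((u - l) / \<eta> - 1) ^ CARD('d) \<le> real (card A)" if "0 \<le> (u - l) / \<eta> - 1"
    unfolding c of_nat_power by (rule power_mono[OF I(3) that])
qed

lemma sets_sqbox [measurable]: "(sqbox l u :: (real ^ 'd) set) \<in> sets borel"
  by (simp add: sqbox_cbox)

lemma emeasure_sqbox:
  assumes "l \<le> u"
  shows "emeasure lborel (sqbox l u :: (real ^ 'd) set) = ennreal ((u - l) ^ CARD('d))"
proof -
  have "emeasure lborel (sqbox l u :: (real ^ 'd) set) = ennreal (\<Prod>b\<in>Basis. (vec u - vec l :: real ^ 'd) \<bullet> b)"
    unfolding sqbox_cbox using assms
    by (intro emeasure_lborel_cbox) (auto simp: Basis_vec_def inner_axis)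
  also have "(\<Prod>b\<in>Basis. (vec u - vec l :: real ^ 'd) \<bullet> b) = (\<Prod>b\<in>(Basis :: (real ^ 'd) set). u - l)"
    by (rule prod.cong) (auto simp: Basis_vec_def inner_axis)
  finally show ?thesis by simp
qed

text \<open>The factor \<open>\<eta> ^ CARD('d)\<close> turns the lattice count into the volume of a
  box whose side is off by at most \<open>\<eta>\<close>. At \<open>\<eta> = 0\<close> both bounds
  are the exact Lebesgue volume, so one statement serves both kinds of measure.\<close>

lemma emeasure_grid_measure_sqbox:
  assumes "0 \<le> \<eta>" "l \<le> u"
  shows "emeasure (grid_measure \<eta>) (sqbox l u \<inter> grid \<eta> :: (real ^ 'd) set) \<le> ennreal ((u - l + \<eta>) ^ CARD('d))"
    and "0 \<le> u - l - \<eta> \<Longrightarrow>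
      ennreal ((u - l - \<eta>) ^ CARD('d)) \<le> emeasure (grid_measure \<eta>) (sqbox l u \<inter> grid \<eta> :: (real ^ 'd) set)"
proof -
  let ?A = "sqbox l u \<inter> grid \<eta> :: (real ^ 'd) set"
  have "emeasure (grid_measure \<eta>) ?A \<le> ennreal ((u - l + \<eta>) ^ CARD('d)) \<and>
    (0 \<le> u - l - \<eta> \<longrightarrow> ennreal ((u - l - \<eta>) ^ CARD('d)) \<le> emeasure (grid_measure \<eta>) ?A)"
  proof (cases "\<eta> = 0")
    case True
    then show ?thesis
      using emeasure_sqbox[OF assms(2), where 'd='d] by (simp add: grid_measure_def grid_def)
  next
    case False
    then have \<eta>: "\<eta> > 0" using assms by simp
    note card = card_sqbox_grid[OF \<eta> assms(2), where 'd='d]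
    have "emeasure (grid_measure \<eta>) ?A = ennreal (\<eta> ^ CARD('d)) * of_nat (card ?A)"
      using False card(1) by (simp add: grid_measure_def emeasure_scale_measure)
    also have "\<dots> = ennreal (\<eta> ^ CARD('d) * real (card ?A))"
      using \<eta> by (simp add: ennreal_mult ennreal_of_nat_eq_real_of_nat)
    finally have e: "emeasure (grid_measure \<eta>) ?A = ennreal (\<eta> ^ CARD('d) * real (card ?A))" .
    have "\<eta> ^ CARD('d) * real (card ?A) \<le> \<eta> ^ CARD('d) * ((u - l) / \<eta> + 1) ^ CARD('d)"
      using \<eta> card(2) by (intro mult_left_mono) auto
    also have "\<dots> = (u - l + \<eta>) ^ CARD('d)"
      using \<eta> by (simp add: power_mult_distrib[symmetric] field_simps)
    finally have 1: "\<eta> ^ CARD('d) * real (card ?A) \<le> (u - l + \<eta>) ^ CARD('d)" .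
    have 2: "(u - l - \<eta>) ^ CARD('d) \<le> \<eta> ^ CARD('d) * real (card ?A)" if "0 \<le> u - l - \<eta>"
    proof -
      have "(u - l - \<eta>) ^ CARD('d) = \<eta> ^ CARD('d) * ((u - l) / \<eta> - 1) ^ CARD('d)"
        using \<eta> by (simp add: power_mult_distrib[symmetric] field_simps)
      also have "\<dots> \<le> \<eta> ^ CARD('d) * real (card ?A)"
        using \<eta> that by (intro mult_left_mono card(3)) (auto simp: field_simps)
      finally show ?thesis .
    qed
    show ?thesis unfolding e using 1 2 by (auto intro: ennreal_leI)
  qed
  then show "emeasure (grid_measure \<eta>) ?A \<le> ennreal ((u - l + \<eta>) ^ CARD('d))"
    and "0 \<le> u - l - \<eta> \<Longrightarrow> ennreal ((u - l - \<eta>) ^ CARD('d)) \<le> emeasure (grid_measure \<eta>) ?A" by auto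
qed

text \<open>Rounding every coordinate down to a multiple of \<open>a\<close> gives the corner of a
  cell containing \<open>t\<close>; as \<open>t\<close> has nonnegative coordinates, the corner
  stays in the cube.\<close>

lemma cube_covering:
  assumes "a > 0" and t: "t \<in> sqbox 0 T"
  shows "\<exists>q \<in> sqbox 0 T \<inter> grid a. t - q \<in> sqbox 0 a"
proof -
  define q where "q = (\<chi> i. a * of_int \<lfloor>t $ i / a\<rfloor>)"
  have b: "0 \<le> t $ i - q $ i \<and> t $ i - q $ i \<le> a" for i
  proof -
    have "of_int \<lfloor>t $ i / a\<rfloor> \<le> t $ i / a" "t $ i / a \<le> of_int \<lfloor>t $ i / a\<rfloor> + 1" by linarith+
    from mult_left_mono[OF this(1), of a] mult_left_mono[OF this(2), of a]
    show ?thesis using assms(1) by (simp add: q_def distrib_left)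
  qed
  have n: "0 \<le> q $ i" for i using t assms(1) by (simp add: q_def sqbox_def)
  have "q \<in> grid a" using assms(1) by (auto simp: grid_def q_def)
  moreover have "q \<in> sqbox 0 T" unfolding sqbox_def mem_Collect_eq
  proof
    fix i show "0 \<le> q $ i \<and> q $ i \<le> T"
      using b[of i] n[of i] t by (auto simp: sqbox_def intro: order_trans[of _ "t $ i"])
  qed
  ultimately show ?thesis using b by (intro bexI[of _ q]) (auto simp: sqbox_def)
qed

text \<open>Grid translations move every point into one fundamental cell; this is what allows an
  integral over the whole space to be folded onto that cell.\<close>

lemma grid_covering:
  assumes "\<eta> > 0"
  shows "\<exists>u \<in> grid \<eta>. t + u \<in> sqbox 0 \<eta>"
proof -
  define q where "q = (\<chi> i. \<eta> * of_int (- \<lfloor>t $ i / \<eta>\<rfloor>))"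
  have b: "0 \<le> t $ i + q $ i \<and> t $ i + q $ i \<le> \<eta>" for i
  proof -
    have "of_int \<lfloor>t $ i / \<eta>\<rfloor> \<le> t $ i / \<eta>" "t $ i / \<eta> \<le> of_int \<lfloor>t $ i / \<eta>\<rfloor> + 1" by linarith+
    from mult_left_mono[OF this(1), of \<eta>] mult_left_mono[OF this(2), of \<eta>]
    show ?thesis using assms(1) by (simp add: q_def distrib_left)
  qed
  have "q \<in> grid \<eta>" unfolding grid_def q_def using assms by (auto intro!: exI[of _ "- \<lfloor>_\<rfloor>"])
  then show ?thesis using b by (intro bexI[of _ q]) (auto simp: sqbox_def)
qed

subsection \<open>Laws of path-valued fields\<close>

lemma shift_shift: "shift_field r (shift_field s f) = shift_field (r + s) f"
  by (simp add: shift_field_def algebra_simps)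

lemma shift_zero: "shift_field 0 f = f"
  by (simp add: shift_field_def)

lemma shift_field_scale: "shift_field h (\<lambda>t. u * f t) = (\<lambda>t. u * shift_field h f t)"
  by (simp add: shift_field_def)

text \<open>Quotients of two \<open>1\<close>-homogeneous functionals thereby become
  \<open>0\<close>-homogeneous, the form to which tilting applies.\<close>

lemma ennreal_divide_scale: "u > 0 \<Longrightarrow> (ennreal u * a) / (ennreal u * b) = a / b"
  using divide_mult_eq[of "ennreal u" a b] by (simp add: mult.commute)

text \<open>The locale collects the properties of the law of the paths that drive the argument. In
  \<open>tilt\<close> the functional may take the value infinity, as a supremum divided by
  \<open>S \<eta>\<close> can.\<close>

locale tilted_stationary = prob_space P for P :: "(real ^ 'd \<Rightarrow> real) measure" +
  assumes sets_P [measurable_cong]: "sets P = sets cadlag_space"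
    and mean: "\<And>t. (\<integral>\<^sup>+ f. ennreal (f t) \<partial>P) = 1"
    and sup_finite: "\<And>T. T > 0 \<Longrightarrow> (\<integral>\<^sup>+ f. sup_on (sqbox 0 T) f \<partial>P) < \<infinity>"
    and tilt: "\<And>h F. F \<in> borel_measurable cadlag_space \<Longrightarrow>
      (\<And>u f. u > 0 \<Longrightarrow> f \<in> cadlag \<Longrightarrow> F (\<lambda>t. u * f t) = F f) \<Longrightarrow>
      (\<integral>\<^sup>+ f. ennreal (f h) * F f \<partial>P) = (\<integral>\<^sup>+ f. ennreal (f 0) * F (shift_field h f) \<partial>P)"
begin

declare measurable_S [measurable] measurable_sup_on_sqbox [measurable]
  measurable_sup_on_sqbox_grid [measurable] measurable_sup_on_grid [measurable]

lemma space_P: "space P = cadlag"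
  using sets_eq_imp_space_eq[OF sets_P] by (simp add: space_cadlag_space)

text \<open>Fubini moves the integral over \<open>h\<close> outside the expectation, where the
  tilting identity applies for each \<open>h\<close>. The weight \<open>w\<close> and the map
  \<open>k\<close> accommodate indicators of boxes and displaced evaluation points.\<close>

lemma tilt_integral:
  assumes "sigma_finite_measure L"
    and k [measurable]: "k \<in> L \<rightarrow>\<^sub>M borel" and w [measurable]: "w \<in> borel_measurable L"
    and F [measurable]: "F \<in> borel_measurable cadlag_space"
    and hom: "\<And>u f. u > 0 \<Longrightarrow> f \<in> cadlag \<Longrightarrow> F (\<lambda>t. u * f t) = F f"
  shows "(\<integral>\<^sup>+ f. (\<integral>\<^sup>+ h. w h * ennreal (f (k h)) \<partial>L) * F f \<partial>P) =
    (\<integral>\<^sup>+ h. w h * (\<integral>\<^sup>+ f. ennreal (f 0) * F (shift_field (k h) f) \<partial>P) \<partial>L)"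
proof -
  interpret L: sigma_finite_measure L by fact
  interpret PL: pair_sigma_finite L P ..
  have "(\<integral>\<^sup>+ f. (\<integral>\<^sup>+ h. w h * ennreal (f (k h)) \<partial>L) * F f \<partial>P) =
      (\<integral>\<^sup>+ f. (\<integral>\<^sup>+ h. w h * ennreal (f (k h)) * F f \<partial>L) \<partial>P)"
  proof (rule nn_integral_cong)
    fix f assume "f \<in> space P"
    then have [measurable]: "f \<in> borel_measurable borel"
      by (simp add: space_P cadlag_borel_measurable)
    show "(\<integral>\<^sup>+ h. w h * ennreal (f (k h)) \<partial>L) * F f = (\<integral>\<^sup>+ h. w h * ennreal (f (k h)) * F f \<partial>L)"
      by (rule nn_integral_multc[symmetric]) measurable
  qed
  also have "\<dots> = (\<integral>\<^sup>+ h. (\<integral>\<^sup>+ f. w h * ennreal (f (k h)) * F f \<partial>P) \<partial>L)"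
    by (rule PL.Fubini') measurable
  also have "\<dots> = (\<integral>\<^sup>+ h. w h * (\<integral>\<^sup>+ f. ennreal (f (k h)) * F f \<partial>P) \<partial>L)"
    unfolding mult.assoc by (intro nn_integral_cong nn_integral_cmult) measurable
  also have "\<dots> = (\<integral>\<^sup>+ h. w h * (\<integral>\<^sup>+ f. ennreal (f 0) * F (shift_field (k h) f) \<partial>P) \<partial>L)"
    using tilt[OF F hom] by simp
  finally show ?thesis .
qed

end

text \<open>After division by \<open>T ^ D\<close> the ratios \<open>(T + m) / T\<close> and
  \<open>(T / a + 1) / T\<close> tend to \<open>1\<close> and \<open>1 / a\<close>. The dissipative
  and the conservative estimate both have this shape: a volume term plus a cell count times an
  error.\<close>

lemma eventually_upper:
  fixes e :: "real \<Rightarrow> ennreal"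
  assumes bound: "\<And>T. T > 0 \<Longrightarrow>
      e T \<le> c * ennreal ((T + m) ^ D) + ennreal ((T / a + 1) ^ D) * p"
    and a: "a > 0" and c: "c < \<infinity>" and p: "p < \<infinity>" and m: "m \<ge> 0"
    and y: "c + ennreal ((1 / a) ^ D) * p < y"
  shows "\<forall>\<^sub>F T in at_top. e T / ennreal (T ^ D) < y"
proof -
  define r where "r T = c * ennreal (((T + m) / T) ^ D) + ennreal (((T / a + 1) / T) ^ D) * p" for T
  have 1: "((\<lambda>T. (T + m) / T) \<longlongrightarrow> 1) at_top" for m :: real by real_asymp
  have "((\<lambda>T. (T * b + 1) / T) \<longlongrightarrow> b) at_top" for b :: real by real_asymp
  from this[of "1 / a"] have "((\<lambda>T. (T / a + 1) / T) \<longlongrightarrow> 1 / a) at_top" by simp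
  then have "(r \<longlongrightarrow> c * ennreal (1 ^ D) + ennreal ((1 / a) ^ D) * p) at_top"
    unfolding r_def mult.commute[of _ p]
    by (intro tendsto_add ennreal_tendsto_cmult c[unfolded infinity_ennreal_def]
        p[unfolded infinity_ennreal_def] tendsto_ennrealI tendsto_power 1)
  then have "\<forall>\<^sub>F T in at_top. r T < y" using y by (intro order_tendstoD(2)) auto
  then show ?thesis
    using eventually_gt_at_top[of 0]
  proof eventually_elim
    case (elim T)
    have "e T / ennreal (T ^ D) \<le>
        (c * ennreal ((T + m) ^ D) + ennreal ((T / a + 1) ^ D) * p) / ennreal (T ^ D)"
      using bound[OF elim(2)] by (rule divide_right_mono_ennreal)
    also have "\<dots> = c * (ennreal ((T + m) ^ D) / ennreal (T ^ D)) +
        (ennreal ((T / a + 1) ^ D) / ennreal (T ^ D)) * p"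
      unfolding divide_ennreal_def by (simp add: distrib_left distrib_right mult_ac)
    also have "\<dots> = r T"
      using elim(2) m a unfolding r_def by (simp add: divide_ennreal power_divide)
    finally show ?case using elim(1) by simp
  qed
qed

context tilted_stationary
begin

subsection \<open>The dissipative part\<close>

definition finite_ind :: "(real ^ 'd \<Rightarrow> real) \<Rightarrow> ennreal" where
  "finite_ind f = indicator {f. S 0 f < \<infinity>} f"

lemma measurable_finite_ind [measurable]: "finite_ind \<in> borel_measurable cadlag_space"
  unfolding finite_ind_def[abs_def] by measurable

lemma finite_ind_shift: "f \<in> cadlag \<Longrightarrow> finite_ind (shift_field h f) = finite_ind f"
  by (simp add: finite_ind_def indicator_def S_shift_field grid_def)

lemma finite_ind_scale: "f \<in> cadlag \<Longrightarrow> u > 0 \<Longrightarrow> finite_ind (\<lambda>t. u * f t) = finite_ind f"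
  by (auto simp: finite_ind_def indicator_def S_scale ennreal_mult_less_top)

text \<open>This is the weight that remains once the tilt has moved the evaluation point to the
  origin, restricted to dissipative paths.\<close>

definition wt :: "real \<Rightarrow> (real ^ 'd \<Rightarrow> real) \<Rightarrow> ennreal" where
  "wt \<eta> f = ennreal (f 0) / S \<eta> f * finite_ind f"

lemma measurable_wt [measurable]: "wt \<eta> \<in> borel_measurable cadlag_space"
  unfolding wt_def[abs_def] by measurable

end

text \<open>The condition \<open>side\<close> makes multiplication and division by
  \<open>S \<eta> f\<close> cancel on dissipative paths. It admits a vanishing integral as long as
  the supremum vanishes too, so that it fits \<open>\<delta> = \<eta> = 0\<close> as well as the
  grids.\<close>

locale dissipative = tilted_stationary P for P :: "(real ^ 'd \<Rightarrow> real) measure" +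
  fixes \<delta> \<eta> :: real
  assumes eta: "\<eta> \<ge> 0" and grids: "(grid \<eta> :: (real ^ 'd) set) \<subseteq> grid \<delta>"
    and side: "AE f in P. S 0 f < \<infinity> \<longrightarrow> S \<eta> f < \<infinity> \<and> (S \<eta> f = 0 \<longrightarrow> sup_on (grid \<delta>) f = 0)"
begin

definition E :: "real \<Rightarrow> ennreal" where
  "E T = (\<integral>\<^sup>+ f. sup_on (sqbox 0 T \<inter> grid \<delta>) f * finite_ind f \<partial>P)"

text \<open>For \<open>h\<close> in \<open>grid \<eta>\<close> this is \<open>Phi\<close> of the
  cube translated by \<open>- h\<close>. Shifting the path instead of the set makes measurability in
  \<open>h\<close> immediate.\<close>

definition R :: "real \<Rightarrow> real ^ 'd \<Rightarrow> ennreal" where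
  "R T h = (\<integral>\<^sup>+ f. sup_on (sqbox 0 T \<inter> grid \<delta>) (shift_field h f) * wt \<eta> f \<partial>P)"

definition Phi :: "(real ^ 'd) set \<Rightarrow> ennreal" where
  "Phi A = (\<integral>\<^sup>+ f. sup_on (A \<inter> grid \<delta>) f * wt \<eta> f \<partial>P)"

lemma measurable_R [measurable]: "R T \<in> borel_measurable borel"
  unfolding R_def[abs_def] by measurable

text \<open>The supremum is written as \<open>S \<eta> f\<close> times a
  \<open>0\<close>-homogeneous quotient, the first factor is unfolded into an integral over
  \<open>h\<close>, and the tilt is applied under that integral.\<close>

lemma E_eq: "E T = (\<integral>\<^sup>+ h. R T h \<partial>grid_measure \<eta>)"
proof -
  note measurable_ident_grid_measure [measurable]
  let ?F = "\<lambda>f. sup_on (sqbox 0 T \<inter> grid \<delta>) f / S \<eta> f * finite_ind f"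
  have "E T = (\<integral>\<^sup>+ f. S \<eta> f * ?F f \<partial>P)"
    unfolding E_def
  proof (rule nn_integral_cong_AE)
    show "AE f in P. sup_on (sqbox 0 T \<inter> grid \<delta>) f * finite_ind f = S \<eta> f * ?F f"
      using side
    proof eventually_elim
      case (elim f)
      show ?case
      proof (cases "S 0 f < \<infinity>")
        case True
        then have f: "S \<eta> f < \<infinity>" "S \<eta> f = 0 \<longrightarrow> sup_on (grid \<delta>) f = 0" using elim by auto
        show ?thesis
        proof (cases "S \<eta> f = 0")
          case True
          then have "sup_on (sqbox 0 T \<inter> grid \<delta>) f = 0"
            using f sup_on_mono[of "sqbox 0 T \<inter> grid \<delta>" "grid \<delta>" f] by auto
          then show ?thesis using True by simp
        next
          case False
          then have "S \<eta> f * (sup_on (sqbox 0 T \<inter> grid \<delta>) f / S \<eta> f) = sup_on (sqbox 0 T \<inter> grid \<delta>) f"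
            using f(1) by (metis ennreal_times_divide infinity_ennreal_def mult.commute
                mult_divide_eq_ennreal less_irrefl)
          then show ?thesis by (simp add: mult.assoc[symmetric])
        qed
      qed (simp add: finite_ind_def)
    qed
  qed
  also have "\<dots> = (\<integral>\<^sup>+ f. (\<integral>\<^sup>+ h. 1 * ennreal (f h) \<partial>grid_measure \<eta>) * ?F f \<partial>P)"
    by (simp add: S_def)
  also have "\<dots> = (\<integral>\<^sup>+ h. 1 * (\<integral>\<^sup>+ f. ennreal (f 0) * ?F (shift_field h f) \<partial>P) \<partial>grid_measure \<eta>)"
  proof (rule tilt_integral[OF sigma_finite_grid_measure])
    show "?F (\<lambda>t. u * f t) = ?F f" if "u > 0" "f \<in> cadlag" for u f
      using that by (simp add: sup_on_scale S_scale finite_ind_scale ennreal_divide_scale)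
  qed measurable
  \<comment> \<open>For \<open>h\<close> in the grid, \<open>S \<eta>\<close> and
    \<open>finite_ind\<close> do not see the shift, so it remains only in the supremum.\<close>
  also have "\<dots> = (\<integral>\<^sup>+ h. R T h \<partial>grid_measure \<eta>)"
  proof (rule nn_integral_cong)
    fix h :: "real ^ 'd" assume "h \<in> space (grid_measure \<eta>)"
    then have h: "h \<in> grid \<eta>" by (simp add: space_grid_measure)
    show "1 * (\<integral>\<^sup>+ f. ennreal (f 0) * ?F (shift_field h f) \<partial>P) = R T h"
      unfolding R_def mult_1
      by (rule nn_integral_cong)
        (simp add: space_P finite_ind_shift S_shift_field[OF _ h] wt_def divide_ennreal_def mult_ac)
  qed
  finally show ?thesis .
qed

lemma sup_on_shift_grid:
  fixes h :: "real ^ 'd"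
  assumes "h \<in> grid \<eta>"
  shows "sup_on (A \<inter> grid \<delta>) (shift_field h f) = sup_on ({t. t + h \<in> A} \<inter> grid \<delta>) f"
proof -
  have "{t. t + h \<in> A \<inter> grid \<delta>} = {t. t + h \<in> A} \<inter> grid \<delta>"
    using grid_add_iff[OF subsetD[OF grids assms]] by auto
  then show ?thesis by (simp add: sup_on_shift)
qed

text \<open>For \<open>h\<close> at depth at least \<open>m\<close> inside the cube, the cube
  translated by \<open>- h\<close> still contains the box of radius \<open>m\<close>, so
  \<open>R T h\<close> is at least \<open>Phi\<close> of that box. The inner cube has side
  \<open>T - 2 * m\<close>, and a grid loses at most another \<open>\<eta>\<close>.\<close>

lemma E_lower:
  assumes "0 \<le> m" "0 \<le> T - 2 * m - \<eta>"
  shows "Phi (sqbox (- m) m) * ennreal ((T - 2 * m - \<eta>) ^ CARD('d)) \<le> E T"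
proof -
  have "Phi (sqbox (- m) m) * ennreal ((T - 2 * m - \<eta>) ^ CARD('d))
      \<le> Phi (sqbox (- m) m) * emeasure (grid_measure \<eta>) (sqbox m (T - m) \<inter> grid \<eta> :: (real ^ 'd) set)"
    using emeasure_grid_measure_sqbox(2)[OF eta, of m "T - m", where 'd='d] assms eta
    by (intro mult_left_mono) (auto simp: algebra_simps)
  also have "\<dots> = (\<integral>\<^sup>+ h. Phi (sqbox (- m) m) * indicator (sqbox m (T - m) \<inter> grid \<eta>) h
      \<partial>(grid_measure \<eta> :: (real ^ 'd) measure))"
    by (rule nn_integral_cmult_indicator[symmetric]) (intro sets_grid_measure_Int sets_sqbox)
  also have "\<dots> \<le> (\<integral>\<^sup>+ h. R T h \<partial>grid_measure \<eta>)"
  proof (rule nn_integral_mono)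
    fix h :: "real ^ 'd" assume "h \<in> space (grid_measure \<eta>)"
    then have h: "h \<in> grid \<eta>" by (simp add: space_grid_measure)
    show "Phi (sqbox (- m) m) * indicator (sqbox m (T - m) \<inter> grid \<eta>) h \<le> R T h"
    proof (cases "h \<in> sqbox m (T - m)")
      case True
      have "sqbox (- m) m \<subseteq> {t. t + h \<in> sqbox 0 T}"
      proof
        fix t :: "real ^ 'd" assume t: "t \<in> sqbox (- m) m"
        have "0 \<le> t $ i + h $ i \<and> t $ i + h $ i \<le> T" for i
        proof -
          have "- m \<le> t $ i" "t $ i \<le> m" "m \<le> h $ i" "h $ i \<le> T - m"
            using t True by (auto simp: sqbox_def)
          then show ?thesis by linarith
        qed
        then show "t \<in> {t. t + h \<in> sqbox 0 T}" by (simp add: sqbox_def)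
      qed
      then have "Phi (sqbox (- m) m) \<le> R T h"
        unfolding Phi_def R_def sup_on_shift_grid[OF h]
        by (intro nn_integral_mono mult_right_mono sup_on_mono) auto
      then show ?thesis by (simp add: indicator_def)
    qed simp
  qed
  finally show ?thesis by (simp add: E_eq)
qed

lemma R_le_Phi: "(h :: real ^ 'd) \<in> grid \<eta> \<Longrightarrow> R T h \<le> Phi UNIV"
  unfolding Phi_def R_def by (auto simp: sup_on_shift_grid intro!: nn_integral_mono mult_right_mono sup_on_mono)

text \<open>The side of the covering cells has to be positive, and the cell corners have to lie in
  \<open>grid \<eta>\<close> so that the measure is invariant under them.\<close>

definition step :: real where "step = (if \<eta> = 0 then 1 else \<eta>)"

lemma step: "step > 0" "(grid step :: (real ^ 'd) set) \<subseteq> grid \<eta>"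
  using eta by (auto simp: step_def grid_def)

definition Q :: "real \<Rightarrow> (real ^ 'd) set" where
  "Q T = sqbox 0 T \<inter> grid step"

lemma Q: "T > 0 \<Longrightarrow> finite (Q T)" "T > 0 \<Longrightarrow> real (card (Q T)) \<le> (T / step + 1) ^ CARD('d)"
  using card_sqbox_grid[OF step(1), of 0 T, where 'd='d] by (auto simp: Q_def)

text \<open>A supremum over a union is at most the sum of the suprema over its pieces. The cell
  corners belong to \<open>grid \<delta>\<close>, so moving a cell to the origin preserves the
  restriction to that grid.\<close>

lemma R_cover:
  assumes "T > 0" "h \<in> grid \<eta>"
  shows "R T h \<le> (\<Sum>q\<in>Q T. R step (h - q))"
proof -
  have "sup_on (sqbox 0 T \<inter> grid \<delta>) (shift_field h f) \<le>
      (\<Sum>q\<in>Q T. sup_on (sqbox 0 step \<inter> grid \<delta>) (shift_field (h - q) f))" for f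
    unfolding sup_on_def[of "sqbox 0 T \<inter> grid \<delta>"]
  proof (rule SUP_least)
    fix t :: "real ^ 'd" assume t: "t \<in> sqbox 0 T \<inter> grid \<delta>"
    then obtain q where q: "q \<in> Q T" "t - q \<in> sqbox 0 step"
      using cube_covering[OF step(1)] unfolding Q_def by blast
    have "t - q \<in> sqbox 0 step \<inter> grid \<delta>"
      using q t step(2) grids by (auto simp: Q_def intro!: grid_diff)
    from sup_on_upper[OF this, of "shift_field (h - q) f"]
    have "ennreal (shift_field h f t) \<le> sup_on (sqbox 0 step \<inter> grid \<delta>) (shift_field (h - q) f)"
      by (simp add: shift_field_def)
    also have "\<dots> \<le> (\<Sum>q\<in>Q T. sup_on (sqbox 0 step \<inter> grid \<delta>) (shift_field (h - q) f))"
      using q(1) Q(1)[OF assms(1)] by (intro member_le_sum) auto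
    finally show "ennreal (shift_field h f t) \<le> \<dots>" .
  qed
  then have "R T h \<le> (\<integral>\<^sup>+ f. (\<Sum>q\<in>Q T. sup_on (sqbox 0 step \<inter> grid \<delta>) (shift_field (h - q) f) * wt \<eta> f) \<partial>P)"
    unfolding R_def sum_distrib_right[symmetric] by (intro nn_integral_mono mult_right_mono) auto
  also have "\<dots> = (\<Sum>q\<in>Q T. R step (h - q))"
    unfolding R_def by (intro nn_integral_sum) measurable
  finally show ?thesis .
qed

text \<open>This is the tail of the integral that represents \<open>E step\<close>; it measures how
  much a unit of covering gains from shifts far away from it.\<close>

definition psi :: "real \<Rightarrow> ennreal" where
  "psi m = (\<integral>\<^sup>+ h. R step h * indicator (- sqbox (- m) m) h \<partial>grid_measure \<eta>)"

lemma E_step_finite: "E step < \<infinity>"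
proof -
  have "E step \<le> (\<integral>\<^sup>+ f. sup_on (sqbox 0 step) f \<partial>P)"
    unfolding E_def by (intro nn_integral_mono) (auto simp: finite_ind_def indicator_def intro: sup_on_mono)
  also have "\<dots> < \<infinity>" by (rule sup_finite[OF step(1)])
  finally show ?thesis .
qed

text \<open>By translation invariance all summands agree, so only the number of cells
  matters.\<close>

lemma cover_integral:
  assumes T: "T > 0" and g: "g \<in> borel_measurable borel"
  shows "(\<Sum>q\<in>Q T. \<integral>\<^sup>+ h. g (h - q) \<partial>grid_measure \<eta>)
    \<le> ennreal ((T / step + 1) ^ CARD('d)) * (\<integral>\<^sup>+ h. g h \<partial>grid_measure \<eta>)"
proof -
  have "(\<integral>\<^sup>+ h. g (h - q) \<partial>grid_measure \<eta>) = (\<integral>\<^sup>+ h. g h \<partial>grid_measure \<eta>)" if "q \<in> Q T" for q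
    using nn_integral_grid_measure_shift[OF grid_minus g, of q \<eta>] that step(2) by (auto simp: Q_def)
  then have "(\<Sum>q\<in>Q T. \<integral>\<^sup>+ h. g (h - q) \<partial>grid_measure \<eta>)
      = ennreal (real (card (Q T))) * (\<integral>\<^sup>+ h. g h \<partial>grid_measure \<eta>)"
    by (simp add: ennreal_of_nat_eq_real_of_nat)
  also have "\<dots> \<le> ennreal ((T / step + 1) ^ CARD('d)) * (\<integral>\<^sup>+ h. g h \<partial>grid_measure \<eta>)"
    using Q(2)[OF T] by (intro mult_right_mono ennreal_leI) auto
  finally show ?thesis .
qed

text \<open>This crude bound, without any separation of near and far shifts, serves to prove that
  \<open>Phi UNIV\<close> is finite.\<close>

lemma E_le_E_step:
  assumes T: "T > 0"
  shows "E T \<le> ennreal ((T / step + 1) ^ CARD('d)) * E step"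
proof -
  have "E T \<le> (\<integral>\<^sup>+ h. (\<Sum>q\<in>Q T. R step (h - q)) \<partial>grid_measure \<eta>)"
    unfolding E_eq by (intro nn_integral_mono R_cover[OF T]) (simp add: space_grid_measure)
  also have "\<dots> = (\<Sum>q\<in>Q T. \<integral>\<^sup>+ h. R step (h - q) \<partial>grid_measure \<eta>)"
    by (intro nn_integral_sum measurable_grid_measureI) measurable
  also have "\<dots> \<le> ennreal ((T / step + 1) ^ CARD('d)) * E step"
    unfolding E_eq[of step] by (rule cover_integral[OF T]) measurable
  finally show ?thesis .
qed

text \<open>Shifts \<open>h\<close> in the cube enlarged by \<open>m\<close> are bounded by
  \<open>Phi UNIV\<close>. For any other \<open>h\<close>, every difference \<open>h - q\<close>
  with a cell corner \<open>q\<close> lies outside the box of radius \<open>m\<close>, so the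
  covering bound involves only the tail \<open>psi m\<close>.\<close>

lemma E_upper:
  assumes T: "T > 0" and m: "m \<ge> 0"
  shows "E T \<le> Phi UNIV * ennreal ((T + (2 * m + \<eta>)) ^ CARD('d))
    + ennreal ((T / step + 1) ^ CARD('d)) * psi m"
proof -
  let ?B = "sqbox (- m) (T + m) :: (real ^ 'd) set"
  define g where "g h = R step h * indicator (- sqbox (- m) m) h" for h
  have g [measurable]: "g \<in> borel_measurable borel"
    unfolding g_def[abs_def] by measurable
  have "R T h \<le> Phi UNIV * indicator (?B \<inter> grid \<eta>) h + (\<Sum>q\<in>Q T. g (h - q))"
    if h: "h \<in> grid \<eta>" for h
  proof (cases "h \<in> ?B")
    case True
    then show ?thesis using R_le_Phi[OF h] h by (simp add: add_increasing2)
  next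
    case False
    have "R T h \<le> (\<Sum>q\<in>Q T. R step (h - q))" by (rule R_cover[OF T h])
    also have "\<dots> = (\<Sum>q\<in>Q T. g (h - q))"
    proof (rule sum.cong)
      fix q assume "q \<in> Q T"
      then have q: "0 \<le> q $ i" "q $ i \<le> T" for i by (auto simp: Q_def sqbox_def)
      have "h - q \<notin> sqbox (- m) m"
      proof
        assume b: "h - q \<in> sqbox (- m) m"
        have "- m \<le> h $ i \<and> h $ i \<le> T + m" for i
        proof -
          have "- m \<le> h $ i - q $ i" "h $ i - q $ i \<le> m" using b by (auto simp: sqbox_def)
          then show ?thesis using q[of i] by linarith
        qed
        then have "h \<in> ?B" unfolding sqbox_def by blast
        then show False using False by simp
      qed
      then show "R step (h - q) = g (h - q)" by (simp add: g_def)
    qed simp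
    finally show ?thesis by (simp add: add_increasing)
  qed
  then have "E T \<le> (\<integral>\<^sup>+ h. Phi UNIV * indicator (?B \<inter> grid \<eta>) h + (\<Sum>q\<in>Q T. g (h - q)) \<partial>grid_measure \<eta>)"
    unfolding E_eq by (intro nn_integral_mono) (simp add: space_grid_measure)
  also have "\<dots> = (\<integral>\<^sup>+ h. Phi UNIV * indicator (?B \<inter> grid \<eta>) h \<partial>grid_measure \<eta>)
      + (\<integral>\<^sup>+ h. (\<Sum>q\<in>Q T. g (h - q)) \<partial>grid_measure \<eta>)"
  proof (rule nn_integral_add)
    show "(\<lambda>h. Phi UNIV * indicator (?B \<inter> grid \<eta>) h) \<in>
        borel_measurable (grid_measure \<eta> :: (real ^ 'd) measure)"
      by (intro borel_measurable_times_ennreal borel_measurable_const borel_measurable_indicator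
          sets_grid_measure_Int sets_sqbox)
    show "(\<lambda>h. \<Sum>q\<in>Q T. g (h - q)) \<in> borel_measurable (grid_measure \<eta> :: (real ^ 'd) measure)"
      by (rule measurable_grid_measureI) measurable
  qed
  also have "(\<integral>\<^sup>+ h. (\<Sum>q\<in>Q T. g (h - q)) \<partial>grid_measure \<eta>)
      = (\<Sum>q\<in>Q T. \<integral>\<^sup>+ h. g (h - q) \<partial>grid_measure \<eta>)"
    by (intro nn_integral_sum measurable_grid_measureI) measurable
  also have "\<dots> \<le> ennreal ((T / step + 1) ^ CARD('d)) * psi m"
    unfolding psi_def g_def[symmetric] by (rule cover_integral[OF T g])
  also have "(\<integral>\<^sup>+ h. Phi UNIV * indicator (?B \<inter> grid \<eta>) h \<partial>grid_measure \<eta>)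
      = Phi UNIV * emeasure (grid_measure \<eta>) (?B \<inter> grid \<eta>)"
    by (rule nn_integral_cmult_indicator) (intro sets_grid_measure_Int sets_sqbox)
  also have "\<dots> \<le> Phi UNIV * ennreal ((T + (2 * m + \<eta>)) ^ CARD('d))"
    using emeasure_grid_measure_sqbox(1)[OF eta, of "- m" "T + m", where 'd='d] T m
    by (intro mult_left_mono) (auto simp: algebra_simps)
  finally show ?thesis by (simp add: add_mono)
qed

lemma Phi_SUP: "Phi UNIV = (SUP m::nat. Phi (sqbox (- real m) (real m)))"
proof -
  have "Phi UNIV = (\<integral>\<^sup>+ f. (SUP m::nat. sup_on (sqbox (- real m) (real m) \<inter> grid \<delta>) f * wt \<eta> f) \<partial>P)"
    unfolding Phi_def by (simp add: sup_on_grid_SUP SUP_mult_right_ennreal)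
  also have "\<dots> = (SUP m::nat. Phi (sqbox (- real m) (real m)))"
    unfolding Phi_def
  proof (rule nn_integral_monotone_convergence_SUP)
    show "incseq (\<lambda>m f. sup_on (sqbox (- real m) (real m) \<inter> grid \<delta>) f * wt \<eta> f)"
      by (auto intro!: incseq_SucI le_funI mult_right_mono sup_on_mono simp: sqbox_def)
        (smt (verit))+
  qed measurable
  finally show ?thesis .
qed

text \<open>The boundary loss in \<open>E_lower\<close> disappears after division by the volume.
  Finiteness of the constant allows the limit to pass through the product.\<close>

lemma E_ratio_lower:
  assumes m: "m \<ge> 0" and fin: "Phi (sqbox (- m) m) < \<infinity>" and y: "y < Phi (sqbox (- m) m)"
  shows "\<forall>\<^sub>F T in at_top. y < E T / ennreal (T ^ CARD('d))"
proof -
  define r where "r T = Phi (sqbox (- m) m) * ennreal (((T - 2 * m - \<eta>) / T) ^ CARD('d))" for T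
  have "((\<lambda>T. (T - 2 * m - \<eta>) / T) \<longlongrightarrow> 1) at_top" by real_asymp
  then have "(r \<longlongrightarrow> Phi (sqbox (- m) m) * ennreal (1 ^ CARD('d))) at_top"
    unfolding r_def using fin by (intro ennreal_tendsto_cmult tendsto_ennrealI tendsto_power) auto
  then have "\<forall>\<^sub>F T in at_top. y < r T" using y by (intro order_tendstoD(1)) auto
  then show ?thesis
    using eventually_gt_at_top[of 0] eventually_ge_at_top[of "2 * m + \<eta>"]
  proof eventually_elim
    case (elim T)
    have "r T = Phi (sqbox (- m) m) * (ennreal ((T - 2 * m - \<eta>) ^ CARD('d)) / ennreal (T ^ CARD('d)))"
      using elim unfolding r_def by (simp add: divide_ennreal power_divide)
    also have "\<dots> = Phi (sqbox (- m) m) * ennreal ((T - 2 * m - \<eta>) ^ CARD('d)) / ennreal (T ^ CARD('d))"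
      by (rule ennreal_times_divide)
    also have "\<dots> \<le> E T / ennreal (T ^ CARD('d))"
      using elim m by (intro divide_right_mono_ennreal E_lower) auto
    finally show ?case using elim(1) by simp
  qed
qed

text \<open>A value \<open>y\<close> strictly between the two sides would eventually lie both above
  and below \<open>E T / T ^ d\<close>, by the crude upper bound and by
  \<open>E_ratio_lower\<close>. The point is that the bound does not depend on
  \<open>m\<close>.\<close>

lemma Phi_sqbox_le: "m \<ge> 0 \<Longrightarrow> Phi (sqbox (- m) m) \<le> ennreal ((1 / step) ^ CARD('d)) * E step"
proof (rule ccontr)
  assume m: "m \<ge> 0" and n: "\<not> Phi (sqbox (- m) m) \<le> ennreal ((1 / step) ^ CARD('d)) * E step"
  let ?e = "ennreal ((1 / step) ^ CARD('d)) * E step"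
  obtain y where y: "?e < y" "y < Phi (sqbox (- m) m)" using n dense by (auto simp: not_le)
  \<comment> \<open>With this side length the volume factor in \<open>E_lower\<close> is exactly
    \<open>1\<close>, which gives finiteness for the fixed \<open>m\<close>.\<close>
  define T where "T = 2 * m + \<eta> + 1"
  have fin: "Phi (sqbox (- m) m) < \<infinity>"
  proof -
    have T: "T > 0" "T - 2 * m - \<eta> = 1" using m eta by (auto simp: T_def)
    have "Phi (sqbox (- m) m) \<le> E T" using E_lower[OF m, of T] T by simp
    also have "\<dots> \<le> ennreal ((T / step + 1) ^ CARD('d)) * E step" using E_le_E_step T by simp
    also have "\<dots> < \<infinity>" using E_step_finite by (simp add: ennreal_mult_less_top)
    finally show ?thesis .
  qed
  have "\<forall>\<^sub>F T in at_top. E T / ennreal (T ^ CARD('d)) < y"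
    using E_le_E_step y(1) E_step_finite
    by (intro eventually_upper[where c=0 and m=0 and a=step and p="E step"]) (auto simp: step(1))
  moreover have "\<forall>\<^sub>F T in at_top. y < E T / ennreal (T ^ CARD('d))"
    by (rule E_ratio_lower[OF m fin y(2)])
  ultimately have "\<forall>\<^sub>F T::real in at_top. False" by eventually_elim auto
  then show False by simp
qed

lemma Phi_finite: "Phi UNIV < \<infinity>"
proof -
  have "Phi UNIV \<le> ennreal ((1 / step) ^ CARD('d)) * E step"
    unfolding Phi_SUP by (rule SUP_least) (simp add: Phi_sqbox_le)
  also have "\<dots> < \<infinity>" using E_step_finite by (simp add: ennreal_mult_less_top)
  finally show ?thesis .
qed

text \<open>Dominated convergence applies with \<open>R step\<close>, whose integral is the finite
  \<open>E step\<close>; each \<open>h\<close> is eventually inside the box.\<close>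

lemma psi_tendsto: "(\<lambda>m. psi (real m)) \<longlonglongrightarrow> 0"
proof -
  have [measurable]: "R step \<in> borel_measurable (grid_measure \<eta>)"
    by (rule measurable_grid_measureI) measurable
  have m: "(\<lambda>h. R step h * indicator (- sqbox (- real m) (real m)) h) \<in>
      borel_measurable (grid_measure \<eta>)" for m
    using sets_sqbox[of "- real m" "real m", where 'd='d] by (intro measurable_grid_measureI) measurable
  have "(\<lambda>m. psi (real m)) \<longlonglongrightarrow> (\<integral>\<^sup>+ h. 0 \<partial>(grid_measure \<eta> :: (real ^ 'd) measure))"
    unfolding psi_def
  proof (rule nn_integral_dominated_convergence[where w="R step"])
    show "(\<integral>\<^sup>+ h. R step h \<partial>grid_measure \<eta>) < \<infinity>" using E_step_finite by (simp add: E_eq)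
    show "AE h in grid_measure \<eta>.
        R step h * indicator (- sqbox (- real m) (real m)) h \<le> R step h" for m
      by (auto simp: indicator_def)
    show "AE h in grid_measure \<eta>. (\<lambda>m. R step h * indicator (- sqbox (- real m) (real m)) h) \<longlonglongrightarrow> 0"
    proof (rule AE_I2)
      fix h :: "real ^ 'd"
      obtain n :: nat where n: "h \<in> sqbox (- real n) (real n)" using UN_sqbox by blast
      have "\<forall>\<^sub>F m in sequentially. R step h * indicator (- sqbox (- real m) (real m)) h = 0"
        using eventually_ge_at_top[of n]
      proof eventually_elim
        case (elim m)
        have "h \<in> sqbox (- real m) (real m)" unfolding sqbox_def mem_Collect_eq
        proof
          fix i
          have "- real n \<le> h $ i" "h $ i \<le> real n" using n by (auto simp: sqbox_def)
          then show "- real m \<le> h $ i \<and> h $ i \<le> real m" using elim by linarith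
        qed
        then show ?case by simp
      qed
      then show "(\<lambda>m. R step h * indicator (- sqbox (- real m) (real m)) h) \<longlonglongrightarrow> 0"
        by (rule tendsto_eventually)
    qed
  qed (use m in auto)
  then show ?thesis by simp
qed

lemma psi_finite: "psi m < \<infinity>"
proof -
  have "psi m \<le> E step" unfolding psi_def E_eq by (intro nn_integral_mono) (auto simp: indicator_def)
  then show ?thesis using E_step_finite by simp
qed

text \<open>From below, a large box already brings \<open>Phi\<close> above \<open>y\<close>. From
  above, \<open>m\<close> is fixed so large that the tail term fits into the gap to
  \<open>y\<close>, and only then does \<open>T\<close> tend to infinity.\<close>

lemma E_ratio_tendsto: "((\<lambda>T. E T / ennreal (T ^ CARD('d))) \<longlongrightarrow> Phi UNIV) at_top"
proof (rule order_tendstoI)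
  fix y assume "y < Phi UNIV"
  then obtain m :: nat where m: "y < Phi (sqbox (- real m) (real m))"
    unfolding Phi_SUP less_SUP_iff by blast
  have "Phi (sqbox (- real m) (real m)) \<le> Phi UNIV" unfolding Phi_SUP by (rule SUP_upper) simp
  then have "Phi (sqbox (- real m) (real m)) < \<infinity>" using Phi_finite by (rule le_less_trans)
  then show "\<forall>\<^sub>F T in at_top. y < E T / ennreal (T ^ CARD('d))"
    using m by (intro E_ratio_lower[of "real m"]) auto
next
  fix y assume y: "Phi UNIV < y"
  have "(\<lambda>m. Phi UNIV + ennreal ((1 / step) ^ CARD('d)) * psi (real m)) \<longlonglongrightarrow>
      Phi UNIV + ennreal ((1 / step) ^ CARD('d)) * 0"
    by (intro tendsto_add tendsto_const ennreal_tendsto_cmult psi_tendsto) simp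
  then have "\<forall>\<^sub>F m in sequentially. Phi UNIV + ennreal ((1 / step) ^ CARD('d)) * psi (real m) < y"
    using y by (intro order_tendstoD(2)) auto
  then obtain m where m: "Phi UNIV + ennreal ((1 / step) ^ CARD('d)) * psi (real m) < y"
    by (auto simp: eventually_sequentially)
  show "\<forall>\<^sub>F T in at_top. E T / ennreal (T ^ CARD('d)) < y"
    by (rule eventually_upper[OF E_upper[of _ "real m"] step(1) Phi_finite psi_finite _ m])
      (use eta in auto)
qed

end

subsection \<open>The conservative part\<close>

text \<open>A local version of \<open>S 0\<close>. The box enters as a weight so that
  \<open>tilt_integral\<close> applies with an indicator for \<open>w\<close>.\<close>

definition mass :: "real \<Rightarrow> real \<Rightarrow> (real ^ 'd \<Rightarrow> real) \<Rightarrow> ennreal" where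
  "mass l u f = (\<integral>\<^sup>+ h. indicator (sqbox l u) h * ennreal (f h) \<partial>lborel)"

lemma measurable_mass [measurable]:
  "mass l u \<in> borel_measurable (cadlag_space :: (real ^ 'd \<Rightarrow> real) measure)"
  unfolding mass_def[abs_def]
proof (rule lborel.borel_measurable_nn_integral)
  show "(\<lambda>(f, h). indicator (sqbox l u) h * ennreal (f h)) \<in>
      borel_measurable ((cadlag_space :: (real ^ 'd \<Rightarrow> real) measure) \<Otimes>\<^sub>M lborel)"
    unfolding case_prod_beta' by measurable
qed

lemma mass_scale:
  assumes "f \<in> cadlag" "u \<ge> 0"
  shows "mass l b (\<lambda>t. u * f t) = ennreal u * mass l b f"
proof -
  have [measurable]: "f \<in> borel_measurable borel" by (rule cadlag_borel_measurable) fact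
  have "mass l b (\<lambda>t. u * f t) = (\<integral>\<^sup>+ h. ennreal u * (indicator (sqbox l b) h * ennreal (f h)) \<partial>lborel)"
    unfolding mass_def using assms
    by (intro nn_integral_cong) (simp add: ennreal_mult cadlag_nonneg mult_ac)
  also have "\<dots> = ennreal u * mass l b f"
    unfolding mass_def by (rule nn_integral_cmult) measurable
  finally show ?thesis .
qed

lemma mass_shift_field:
  assumes "f \<in> cadlag"
  shows "mass l b (shift_field r f) = (\<integral>\<^sup>+ h. indicator (sqbox l b) (h + r) * ennreal (f h) \<partial>lborel)"
proof -
  have [measurable]: "f \<in> borel_measurable borel" by (rule cadlag_borel_measurable) fact
  have "(\<integral>\<^sup>+ t. indicator (sqbox l b) t * ennreal (f (t - r)) \<partial>lborel)
      = (\<integral>\<^sup>+ t. indicator (sqbox l b) (t + r) * ennreal (f (t + r - r)) \<partial>lborel)"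
    using nn_integral_grid_measure_shift[of r 0 "\<lambda>t. indicator (sqbox l b) t * ennreal (f (t - r))"]
    by (simp add: grid_def grid_measure_def)
  then show ?thesis by (simp add: mass_def shift_field_def)
qed

text \<open>By right-continuity \<open>f\<close> is positive on a small cube with lower corner
  \<open>t\<close>, and the strict bound \<open>t $ i < u\<close> leaves room for that cube in the
  box.\<close>

lemma mass_pos:
  fixes f :: "real ^ 'd \<Rightarrow> real"
  assumes f: "f \<in> cadlag" and t: "\<And>i. l \<le> t $ i" "\<And>i. t $ i < u" and pos: "f t > 0"
  shows "mass l u f > 0"
proof (rule ccontr)
  assume "\<not> mass l u f > 0"
  have [measurable]: "f \<in> borel_measurable borel" by (rule cadlag_borel_measurable) fact
  have "mass l u f = 0" using \<open>\<not> mass l u f > 0\<close> by simp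
  then have ae: "AE h in lborel. indicator (sqbox l u) h * ennreal (f h) = 0"
    unfolding mass_def by (subst (asm) nn_integral_0_iff_AE) measurable
  from order_tendstoD(1)[OF cadlag_right_continuous[OF f] pos] obtain e where e: "e > 0"
    and eq: "\<And>s. s \<in> orthant UNIV t \<Longrightarrow> s \<noteq> t \<Longrightarrow> dist s t < e \<Longrightarrow> 0 < f s"
    unfolding eventually_at by metis
  define m where "m = Min (range (\<lambda>i. u - t $ i))"
  have m: "m > 0" "\<And>i. m \<le> u - t $ i" using t(2) by (auto simp: m_def)
  \<comment> \<open>The factor \<open>2\<close> leaves the closed cube strictly inside the open
    \<open>e\<close>-ball, and \<open>m\<close> keeps it below the upper faces.\<close>
  define e' where "e' = min m (e / (2 * CARD('d)))"
  have e': "e' > 0" "e' \<le> m" "e' \<le> e / (2 * CARD('d))" using e m by (auto simp: e'_def)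
  let ?C = "cbox t (t + vec e')"
  have C: "indicator (sqbox l u) h * ennreal (f h) \<noteq> 0" if h: "h \<in> ?C" for h
  proof -
    have b: "t $ i \<le> h $ i" "h $ i \<le> t $ i + e'" for i using h by (auto simp: mem_box_cart)
    have "dist h t \<le> (\<Sum>i\<in>UNIV. \<bar>(h - t) $ i\<bar>)"
      unfolding dist_norm by (rule norm_le_l1_cart)
    also have "\<dots> \<le> (\<Sum>i\<in>(UNIV :: 'd set). e')"
    proof (rule sum_mono)
      fix i show "\<bar>(h - t) $ i\<bar> \<le> e'" using b[of i] by simp
    qed
    also have "\<dots> = CARD('d) * e'" by simp
    also have "\<dots> \<le> CARD('d) * (e / (2 * CARD('d)))" using e'(3) by (intro mult_left_mono) auto
    also have "\<dots> < e" using e by simp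
    finally have "dist h t < e" .
    moreover have "h \<in> orthant UNIV t" using b by (auto simp: orthant_def)
    ultimately have "0 < f h" using eq pos by (cases "h = t") auto
    moreover have "l \<le> h $ i \<and> h $ i \<le> u" for i
      using b[of i] t(1)[of i] m(2)[of i] e'(2) by linarith
    then have "h \<in> sqbox l u" by (simp add: sqbox_def)
    ultimately show ?thesis by simp
  qed
  have "AE h in lborel. h \<notin> ?C"
    using ae by eventually_elim (use C in blast)
  then have "emeasure lborel ?C = 0"
    by (subst (asm) AE_iff_measurable[of ?C]) auto
  moreover have "emeasure lborel ?C = ennreal (\<Prod>b\<in>Basis. (t + vec e' - t) \<bullet> b)"
    using e'(1) by (intro emeasure_lborel_cbox) (auto simp: Basis_vec_def inner_axis inner_add_left)
  moreover have "(\<Prod>b\<in>Basis. (t + vec e' - t) \<bullet> b) > 0"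
    using e'(1) by (intro prod_pos) (auto simp: Basis_vec_def inner_axis)
  ultimately show False by (metis ennreal_eq_0_iff not_le)
qed

text \<open>Positivity at a point spreads only to its right, so the mass is taken over a box
  reaching beyond the upper faces of the unit cube.\<close>

lemma mass_eq_0_imp_sup_on_eq_0:
  assumes f: "f \<in> cadlag" and "mass 0 2 f = 0"
  shows "sup_on (sqbox 0 1) f = 0"
proof -
  have "f t = 0" if "t \<in> sqbox 0 1" for t
  proof (rule ccontr)
    assume "f t \<noteq> 0"
    then have "f t > 0" using cadlag_nonneg[OF f, of t] by simp
    then have "mass 0 2 f > 0" using that
      by (intro mass_pos[OF f, of 0 t]) (auto simp: sqbox_def intro: le_less_trans)
    then show False using assms by simp
  qed
  then have "sup_on (sqbox 0 1) f \<le> 0" unfolding sup_on_def by (intro SUP_least) simp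
  then show ?thesis by simp
qed

text \<open>This supplies the condition \<open>side\<close> of \<open>dissipative\<close> for
  \<open>\<delta> = \<eta> = 0\<close>.\<close>

lemma S_eq_0_imp_sup_on_eq_0:
  assumes f: "f \<in> cadlag" and "S 0 f = 0"
  shows "sup_on A f = 0"
proof -
  have "f t = 0" for t
  proof (rule ccontr)
    assume "f t \<noteq> 0"
    then have "f t > 0" using cadlag_nonneg[OF f, of t] by simp
    obtain n :: nat where n: "norm t < real n" using reals_Archimedean2 by blast
    have b: "- real n \<le> t $ i" "t $ i < real n" for i
      using component_le_norm_cart[of t i] n by linarith+
    have "0 < mass (- real n) (real n) f" by (rule mass_pos[OF f b \<open>f t > 0\<close>])
    also have "\<dots> \<le> S 0 f"
      unfolding mass_def S_def grid_measure_def by (auto intro!: nn_integral_mono simp: indicator_def)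
    finally show False using assms by simp
  qed
  then have "sup_on A f \<le> 0" unfolding sup_on_def by (intro SUP_least) simp
  then show ?thesis by simp
qed

lemma mass_incseq: "incseq (\<lambda>m f. mass (- real m) (real m) f)"
proof (rule incseq_SucI, rule le_funI)
  fix m f
  have "sqbox (- real m) (real m) \<subseteq> sqbox (- real (Suc m)) (real (Suc m))"
    by (auto simp: sqbox_def) (smt (verit))+
  then show "mass (- real m) (real m) f \<le> mass (- real (Suc m)) (real (Suc m)) f"
    unfolding mass_def by (intro nn_integral_mono mult_right_mono) (auto simp: indicator_def)
qed

lemma S_SUP_mass:
  fixes f :: "real ^ 'd \<Rightarrow> real"
  assumes "f \<in> cadlag"
  shows "S 0 f = (SUP m::nat. mass (- real m) (real m) f)"
proof -
  have [measurable]: "f \<in> borel_measurable borel" by (rule cadlag_borel_measurable) fact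
  have "(SUP m::nat. mass (- real m) (real m) f) =
      (\<integral>\<^sup>+ h. (SUP m::nat. indicator (sqbox (- real m) (real m)) h * ennreal (f h)) \<partial>lborel)"
    unfolding mass_def
  proof (rule nn_integral_monotone_convergence_SUP[symmetric])
    show "incseq (\<lambda>m h. indicator (sqbox (- real m) (real m)) h * ennreal (f h))"
      by (intro incseq_SucI le_funI mult_right_mono)
        (auto simp: sqbox_def indicator_def, (smt (verit))+)
  qed measurable
  also have "\<dots> = (\<integral>\<^sup>+ h. ennreal (f h) \<partial>lborel)"
  proof (rule nn_integral_cong)
    fix h :: "real ^ 'd"
    obtain n :: nat where n: "h \<in> sqbox (- real n) (real n)" using UN_sqbox by blast
    show "(SUP m::nat. indicator (sqbox (- real m) (real m)) h * ennreal (f h)) = ennreal (f h)"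
    proof (rule antisym)
      show "(SUP m::nat. indicator (sqbox (- real m) (real m)) h * ennreal (f h)) \<le> ennreal (f h)"
        by (rule SUP_least) (auto simp: indicator_def)
      show "ennreal (f h) \<le> (SUP m::nat. indicator (sqbox (- real m) (real m)) h * ennreal (f h))"
        by (rule SUP_upper2[of n]) (use n in auto)
    qed
  qed
  finally show ?thesis by (simp add: S_def grid_measure_def)
qed

context tilted_stationary
begin

text \<open>Tilting with the constant functional \<open>1\<close> reduces the claim to mean one at
  the origin.\<close>

lemma mean_integral:
  assumes "sigma_finite_measure L" "k \<in> L \<rightarrow>\<^sub>M borel" "w \<in> borel_measurable L"
  shows "(\<integral>\<^sup>+ f. (\<integral>\<^sup>+ h. w h * ennreal (f (k h)) \<partial>L) \<partial>P) = (\<integral>\<^sup>+ h. w h \<partial>L)"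
  using tilt_integral[OF assms, of "\<lambda>_. 1"] by (simp add: mean)

text \<open>Writing \<open>G = mass 0 b \<cdot> (G / mass 0 b)\<close> makes the \<open>1\<close>-homogeneous \<open>G\<close> accessible to the
  tilting identity, which only concerns \<open>0\<close>-homogeneous functionals.\<close>

lemma stationary:
  assumes G [measurable]: "G \<in> borel_measurable cadlag_space"
    and hom: "\<And>u f. u > 0 \<Longrightarrow> f \<in> cadlag \<Longrightarrow> G (\<lambda>t. u * f t) = ennreal u * G f"
    and zero: "\<And>f. f \<in> cadlag \<Longrightarrow> mass 0 b f = 0 \<Longrightarrow> G f = 0" and b: "b \<ge> 0"
  shows "(\<integral>\<^sup>+ f. G (shift_field r f) \<partial>P) = (\<integral>\<^sup>+ f. G f \<partial>P)"
proof -
  \<comment> \<open>The right-hand side does not contain \<open>r\<close>; comparing the instances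
    at \<open>r\<close> and at \<open>0\<close> then gives stationarity.\<close>
  have *: "(\<integral>\<^sup>+ f. G (shift_field r f) \<partial>P) = (\<integral>\<^sup>+ h. indicator (sqbox 0 b) h *
      (\<integral>\<^sup>+ f. ennreal (f 0) * (G (shift_field h f) / mass 0 b (shift_field h f)) \<partial>P) \<partial>lborel)"
    (is "_ = ?R") for r
  proof -
    let ?F = "\<lambda>f. G (shift_field r f) / mass 0 b (shift_field r f)"
    have mass_eq: "mass 0 b (shift_field r f) = (\<integral>\<^sup>+ h. indicator (sqbox 0 b) h * ennreal (f (h - r)) \<partial>lborel)" for f
      by (simp add: mass_def shift_field_def)
    have "(\<integral>\<^sup>+ f. mass 0 b (shift_field r f) \<partial>P) = (\<integral>\<^sup>+ h. indicator (sqbox 0 b) h \<partial>(lborel :: (real ^ 'd) measure))"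
      unfolding mass_eq by (rule mean_integral[OF sigma_finite_lborel]) measurable
    also have "\<dots> \<noteq> \<infinity>" using emeasure_sqbox[OF b, where 'd='d] by simp
    finally have "(\<integral>\<^sup>+ f. mass 0 b (shift_field r f) \<partial>P) \<noteq> \<infinity>" .
    from nn_integral_PInf_AE[OF _ this]
    have ae: "AE f in P. mass 0 b (shift_field r f) \<noteq> \<infinity>" by measurable
    have "(\<integral>\<^sup>+ f. G (shift_field r f) \<partial>P) = (\<integral>\<^sup>+ f. mass 0 b (shift_field r f) * ?F f \<partial>P)"
    proof (rule nn_integral_cong_AE)
      show "AE f in P. G (shift_field r f) = mass 0 b (shift_field r f) * ?F f"
        using ae AE_space
      proof eventually_elim
        case (elim f)
        then have f: "shift_field r f \<in> cadlag" by (simp add: space_P shift_field_cadlag)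
        show ?case
        proof (cases "mass 0 b (shift_field r f) = 0")
          case True then show ?thesis using zero[OF f] by simp
        next
          case False
          then show ?thesis using elim(1)
            by (metis ennreal_times_divide infinity_ennreal_def mult.commute mult_divide_eq_ennreal)
        qed
      qed
    qed
    also have "\<dots> = (\<integral>\<^sup>+ f. (\<integral>\<^sup>+ h. indicator (sqbox 0 b) h * ennreal (f (h - r)) \<partial>lborel) * ?F f \<partial>P)"
      by (simp only: mass_eq)
    also have "\<dots> = (\<integral>\<^sup>+ h. indicator (sqbox 0 b) h *
        (\<integral>\<^sup>+ f. ennreal (f 0) * ?F (shift_field (h - r) f) \<partial>P) \<partial>lborel)"
    proof (rule tilt_integral[OF sigma_finite_lborel])
      show "?F (\<lambda>t. u * f t) = ?F f" if "u > 0" "f \<in> cadlag" for u f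
        using that
        by (simp add: shift_field_scale shift_field_cadlag hom mass_scale ennreal_divide_scale)
    qed measurable
    \<comment> \<open>The shift by \<open>r\<close> inside \<open>?F\<close> and the tilting shift
      by \<open>h - r\<close> add up to \<open>h\<close>.\<close>
    also have "\<dots> = ?R" by (simp add: shift_shift)
    finally show ?thesis .
  qed
  show ?thesis using *[of r] *[of 0] by (simp add: shift_zero)
qed

definition infinite_ind :: "(real ^ 'd \<Rightarrow> real) \<Rightarrow> ennreal" where
  "infinite_ind f = indicator {f. S 0 f = \<infinity>} f"

lemma measurable_infinite_ind [measurable]: "infinite_ind \<in> borel_measurable cadlag_space"
  unfolding infinite_ind_def[abs_def] by measurable

lemma infinite_ind_shift: "f \<in> cadlag \<Longrightarrow> infinite_ind (shift_field h f) = infinite_ind f"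
  by (simp add: infinite_ind_def indicator_def S_shift_field grid_def)

lemma infinite_ind_scale: "f \<in> cadlag \<Longrightarrow> u > 0 \<Longrightarrow> infinite_ind (\<lambda>t. u * f t) = infinite_ind f"
  by (auto simp: infinite_ind_def indicator_def S_scale ennreal_mult_eq_top_iff)

text \<open>Both sides of the inequality in the indicator scale alike, so the functional is
  \<open>1\<close>-homogeneous and \<open>stationary\<close> applies to it.\<close>

definition excess :: "real \<Rightarrow> real \<Rightarrow> (real ^ 'd \<Rightarrow> real) \<Rightarrow> ennreal" where
  "excess c m f = sup_on (sqbox 0 1) f *
     indicator {f. ennreal c * mass (- m) m f < sup_on (sqbox 0 1) f} f * infinite_ind f"

lemma measurable_excess [measurable]: "excess c m \<in> borel_measurable cadlag_space"
  unfolding excess_def[abs_def] by measurable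

lemma excess_shift: "(\<integral>\<^sup>+ f. excess c m (shift_field r f) \<partial>P) = (\<integral>\<^sup>+ f. excess c m f \<partial>P)"
proof (rule stationary[where b=2])
  show "excess c m (\<lambda>t. u * f t) = ennreal u * excess c m f" if u: "u > 0" and f: "f \<in> cadlag" for u f
  proof -
    have "ennreal c * (ennreal u * a) < ennreal u * b \<longleftrightarrow> ennreal c * a < b" for a b
      using u ennreal_mult_le_mult_iff[of "ennreal u" b "ennreal c * a"]
      by (simp add: mult.left_commute not_le[symmetric])
    then show ?thesis
      unfolding excess_def using u f
      by (simp add: sup_on_scale mass_scale infinite_ind_scale indicator_def mult.assoc)
  qed
qed (use mass_eq_0_imp_sup_on_eq_0 in \<open>auto simp: excess_def\<close>)

text \<open>On a conservative path the window mass grows to infinity while the cell supremum is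
  almost surely finite, so the indicator is eventually zero; the supremum dominates.\<close>

lemma excess_tendsto:
  assumes c: "c > 0"
  shows "(\<lambda>m. \<integral>\<^sup>+ f. excess c (real m) f \<partial>P) \<longlonglongrightarrow> 0"
proof -
  have fin: "(\<integral>\<^sup>+ f. sup_on (sqbox 0 1) f \<partial>P) < \<infinity>" by (rule sup_finite) simp
  have ae: "AE f in P. sup_on (sqbox 0 1) f \<noteq> \<infinity>"
    by (rule nn_integral_PInf_AE) (use fin in auto)
  have "(\<lambda>m. \<integral>\<^sup>+ f. excess c (real m) f \<partial>P) \<longlonglongrightarrow> (\<integral>\<^sup>+ f. 0 \<partial>P)"
  proof (rule nn_integral_dominated_convergence[where w="sup_on (sqbox 0 1)"])
    show "AE f in P. excess c (real m) f \<le> sup_on (sqbox 0 1) f" for m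
      by (auto simp: excess_def indicator_def infinite_ind_def)
    show "AE f in P. (\<lambda>m. excess c (real m) f) \<longlonglongrightarrow> 0"
      using ae AE_space
    proof eventually_elim
      case (elim f)
      then have f: "f \<in> cadlag" by (simp add: space_P)
      show "(\<lambda>m. excess c (real m) f) \<longlonglongrightarrow> 0"
      proof (cases "S 0 f = \<infinity>")
        case False
        then show ?thesis by (simp add: excess_def infinite_ind_def)
      next
        case True
        have "incseq (\<lambda>m. mass (- real m) (real m) f)"
          using mass_incseq by (auto simp: incseq_def le_fun_def)
        from LIMSEQ_SUP[OF this] have "(\<lambda>m. mass (- real m) (real m) f) \<longlonglongrightarrow> \<infinity>"
          using S_SUP_mass[OF f] True by simp
        then have "(\<lambda>m. ennreal c * mass (- real m) (real m) f) \<longlonglongrightarrow> ennreal c * \<infinity>"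
          by (intro ennreal_tendsto_cmult) auto
        then have "(\<lambda>m. ennreal c * mass (- real m) (real m) f) \<longlonglongrightarrow> \<infinity>"
          using c by (simp add: ennreal_mult_top)
        then have "\<forall>\<^sub>F m in sequentially. sup_on (sqbox 0 1) f < ennreal c * mass (- real m) (real m) f"
          using elim(1) by (intro order_tendstoD(1)) (auto simp: top.not_eq_extremum)
        then have "\<forall>\<^sub>F m in sequentially. excess c (real m) f = 0"
          by eventually_elim (auto simp: excess_def)
        then show ?thesis by (rule tendsto_eventually)
      qed
    qed
  qed (use fin in auto)
  then show ?thesis by simp
qed

text \<open>Let \<open>q\<close> be the corner of a cell containing \<open>t\<close>. Either that
  cell is charged to the sum, or its supremum is at most \<open>c\<close> times the mass of its
  window, which lies inside the cube enlarged by \<open>m\<close>.\<close>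

lemma sup_on_split:
  assumes f: "f \<in> cadlag" and T: "T > 0"
  shows "sup_on (sqbox 0 T) f * infinite_ind f \<le> ennreal c * mass (- m) (T + m) f +
    (\<Sum>q\<in>sqbox 0 T \<inter> grid 1. excess c m (shift_field (- q) f))"
proof (cases "S 0 f = \<infinity>")
  case True
  let ?Q = "sqbox 0 T \<inter> grid 1 :: (real ^ 'd) set"
  have [measurable]: "f \<in> borel_measurable borel" by (rule cadlag_borel_measurable) fact
  have fin: "finite ?Q" using card_sqbox_grid(1)[of 1 0 T] T by simp
  have i: "infinite_ind f = 1" using True by (simp add: infinite_ind_def)
  have "sup_on (sqbox 0 T) f \<le> ennreal c * mass (- m) (T + m) f + (\<Sum>q\<in>?Q. excess c m (shift_field (- q) f))"
    unfolding sup_on_def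
  proof (rule SUP_least)
    fix t :: "real ^ 'd" assume t: "t \<in> sqbox 0 T"
    obtain q where q: "q \<in> ?Q" "t - q \<in> sqbox 0 1" using cube_covering[OF _ t, of 1] by auto
    let ?g = "shift_field (- q) f"
    have le: "ennreal (f t) \<le> sup_on (sqbox 0 1) ?g"
      using sup_on_upper[OF q(2), of ?g] by (simp add: shift_field_def)
    show "ennreal (f t) \<le> ennreal c * mass (- m) (T + m) f + (\<Sum>q\<in>?Q. excess c m (shift_field (- q) f))"
    proof (cases "ennreal c * mass (- m) m ?g < sup_on (sqbox 0 1) ?g")
      case True
      then have "sup_on (sqbox 0 1) ?g = excess c m ?g" using f i by (simp add: excess_def infinite_ind_shift)
      also have "\<dots> \<le> (\<Sum>q\<in>?Q. excess c m (shift_field (- q) f))"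
        using fin q(1) by (intro member_le_sum) auto
      finally show ?thesis using le by (simp add: add_increasing)
    next
      case False
      have "mass (- m) m ?g = (\<integral>\<^sup>+ h. indicator (sqbox (- m) m) (h - q) * ennreal (f h) \<partial>lborel)"
        using mass_shift_field[OF f, of "- m" m "- q"] by simp
      also have "\<dots> \<le> mass (- m) (T + m) f"
        unfolding mass_def
      proof (intro nn_integral_mono mult_right_mono)
        fix h :: "real ^ 'd"
        have "h \<in> sqbox (- m) (T + m)" if b: "h - q \<in> sqbox (- m) m"
          unfolding sqbox_def mem_Collect_eq
        proof
          fix i
          have "- m \<le> h $ i - q $ i" "h $ i - q $ i \<le> m" "0 \<le> q $ i" "q $ i \<le> T"
            using b q(1) by (auto simp: sqbox_def)
          then show "- m \<le> h $ i \<and> h $ i \<le> T + m" by linarith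
        qed
        then show "indicator (sqbox (- m) m) (h - q) \<le> (indicator (sqbox (- m) (T + m)) h :: ennreal)"
          by (auto simp: indicator_def)
      qed simp
      finally have "ennreal c * mass (- m) m ?g \<le> ennreal c * mass (- m) (T + m) f"
        by (rule mult_left_mono) simp
      then show ?thesis using le False by (auto simp: not_less intro!: add_increasing2)
    qed
  qed
  then show ?thesis by (simp add: i)
qed (simp add: infinite_ind_def)

text \<open>The expected mass of a box is its volume, so \<open>sup_on_split\<close> bounds the
  limit by \<open>c\<close> plus the expected excess. The constants are chosen in the order
  \<open>c\<close>, \<open>m\<close>, \<open>T\<close>.\<close>

lemma conservative_tendsto:
  "((\<lambda>T. (\<integral>\<^sup>+ f. sup_on (sqbox 0 T) f * infinite_ind f \<partial>P) / ennreal (T ^ CARD('d))) \<longlongrightarrow> 0) at_top"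
proof (rule order_tendstoI)
  fix y :: ennreal assume y: "0 < y"
  \<comment> \<open>Staying strictly below \<open>y\<close> makes \<open>c\<close> a positive real
    and leaves room for the excess term.\<close>
  obtain z where z: "0 < z" "z < y" using dense[OF y] by blast
  then have "z < \<infinity>" by (auto intro: less_le_trans)
  then obtain c where c: "z = ennreal c" "c > 0" using z by (cases z) auto
  have "(\<lambda>m. ennreal c + ennreal ((1 / 1) ^ CARD('d)) * (\<integral>\<^sup>+ f. excess c (real m) f \<partial>P)) \<longlonglongrightarrow>
      ennreal c + ennreal ((1 / 1) ^ CARD('d)) * 0"
    by (intro tendsto_add tendsto_const ennreal_tendsto_cmult excess_tendsto c) simp
  then have "\<forall>\<^sub>F m in sequentially.
      ennreal c + ennreal ((1 / 1) ^ CARD('d)) * (\<integral>\<^sup>+ f. excess c (real m) f \<partial>P) < y"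
    using z c by (intro order_tendstoD(2)) auto
  then obtain m :: nat
    where m: "ennreal c + ennreal ((1 / 1) ^ CARD('d)) * (\<integral>\<^sup>+ f. excess c (real m) f \<partial>P) < y"
    by (auto simp: eventually_sequentially)
  have "(\<integral>\<^sup>+ f. sup_on (sqbox 0 T) f * infinite_ind f \<partial>P) \<le> ennreal c * ennreal ((T + 2 * real m) ^ CARD('d)) +
      ennreal ((T / 1 + 1) ^ CARD('d)) * (\<integral>\<^sup>+ f. excess c (real m) f \<partial>P)" if T: "T > 0" for T
  proof -
    let ?Q = "sqbox 0 T \<inter> grid 1 :: (real ^ 'd) set"
    have card: "real (card ?Q) \<le> (T / 1 + 1) ^ CARD('d)"
      using card_sqbox_grid(2)[of 1 0 T, where 'd='d] T by simp
    have "(\<integral>\<^sup>+ f. sup_on (sqbox 0 T) f * infinite_ind f \<partial>P) \<le>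
        (\<integral>\<^sup>+ f. ennreal c * mass (- real m) (T + real m) f +
          (\<Sum>q\<in>?Q. excess c (real m) (shift_field (- q) f)) \<partial>P)"
    proof (rule nn_integral_mono)
      fix f assume "f \<in> space P"
      then have "f \<in> cadlag" by (simp add: space_P)
      from sup_on_split[OF this T] show "sup_on (sqbox 0 T) f * infinite_ind f
          \<le> ennreal c * mass (- real m) (T + real m) f +
          (\<Sum>q\<in>?Q. excess c (real m) (shift_field (- q) f))" .
    qed
    also have "\<dots> = ennreal c * (\<integral>\<^sup>+ f. mass (- real m) (T + real m) f \<partial>P) +
        (\<Sum>q\<in>?Q. \<integral>\<^sup>+ f. excess c (real m) (shift_field (- q) f) \<partial>P)"
      by (simp add: nn_integral_add nn_integral_cmult nn_integral_sum)
    also have "(\<integral>\<^sup>+ f. mass (- real m) (T + real m) f \<partial>P) =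
        (\<integral>\<^sup>+ h. indicator (sqbox (- real m) (T + real m)) h \<partial>(lborel :: (real ^ 'd) measure))"
      unfolding mass_def by (rule mean_integral[OF sigma_finite_lborel]) measurable
    also have "\<dots> = ennreal ((T + 2 * real m) ^ CARD('d))"
      using emeasure_sqbox[of "- real m" "T + real m", where 'd='d] T by (simp add: algebra_simps)
    also have "(\<Sum>q\<in>?Q. \<integral>\<^sup>+ f. excess c (real m) (shift_field (- q) f) \<partial>P)
        = ennreal (real (card ?Q)) * (\<integral>\<^sup>+ f. excess c (real m) f \<partial>P)"
      by (simp add: excess_shift ennreal_of_nat_eq_real_of_nat)
    also have "\<dots> \<le> ennreal ((T / 1 + 1) ^ CARD('d)) * (\<integral>\<^sup>+ f. excess c (real m) f \<partial>P)"
      using card by (intro mult_right_mono ennreal_leI) auto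
    finally show ?thesis by (simp add: add_mono)
  qed
  moreover have "(\<integral>\<^sup>+ f. excess c (real m) f \<partial>P) < \<infinity>"
  proof -
    have "(\<integral>\<^sup>+ f. excess c (real m) f \<partial>P) \<le> (\<integral>\<^sup>+ f. sup_on (sqbox 0 1) f \<partial>P)"
      by (rule nn_integral_mono) (auto simp: excess_def indicator_def infinite_ind_def)
    also have "\<dots> < \<infinity>" by (rule sup_finite) simp
    finally show ?thesis .
  qed
  ultimately show "\<forall>\<^sub>F T in at_top. (\<integral>\<^sup>+ f. sup_on (sqbox 0 T) f * infinite_ind f \<partial>P) / ennreal (T ^ CARD('d)) < y"
    by (intro eventually_upper[where a=1 and c="ennreal c" and m="2 * real m", OF _ _ _ _ _ m]) auto
qed simp

end

context tilted_stationary
begin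

text \<open>On the conservative part the sum over a grid is infinite as well: integrating the tilted
  density over \<open>\<real>\<^sup>d\<close> and folding the integral onto one cell of the grid gives a finite value.\<close>

lemma conservative_grid:
  assumes \<eta>: "\<eta> > 0"
  shows "AE f in P. S 0 f = \<infinity> \<longrightarrow> ennreal (f 0) / S \<eta> f = 0"
proof -
  let ?L = "grid_measure \<eta> :: (real ^ 'd) measure"
  interpret L: sigma_finite_measure ?L by (rule sigma_finite_grid_measure)
  interpret LL: pair_sigma_finite ?L "lborel :: (real ^ 'd) measure" ..
  interpret PL: pair_sigma_finite ?L P ..
  let ?c = "ennreal (\<eta> ^ CARD('d))"
  let ?F = "\<lambda>f. ennreal (f 0) / S \<eta> f"
  define g where "g t = (\<integral>\<^sup>+ f. ennreal (f 0) * ?F (shift_field t f) \<partial>P)" for t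
  have g [measurable]: "g \<in> borel_measurable borel"
    unfolding g_def[abs_def] by measurable
  have "(\<integral>\<^sup>+ f. S 0 f * ?F f \<partial>P) = (\<integral>\<^sup>+ f. (\<integral>\<^sup>+ t. 1 * ennreal (f t) \<partial>lborel) * ?F f \<partial>P)"
    by (simp add: S_def grid_measure_def)
  also have "\<dots> = (\<integral>\<^sup>+ t. 1 * g t \<partial>lborel)"
    unfolding g_def
  proof (rule tilt_integral[OF sigma_finite_lborel])
    show "?F (\<lambda>t. u * f t) = ?F f" if "u > 0" "f \<in> cadlag" for u f
      using that by (simp add: S_scale ennreal_divide_scale ennreal_mult cadlag_nonneg)
  qed measurable
  finally have S: "(\<integral>\<^sup>+ f. S 0 f * ?F f \<partial>P) = (\<integral>\<^sup>+ t. g t \<partial>lborel)" by simp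
  note measurable_ident_grid_measure [measurable]
  \<comment> \<open>Over the shifts by grid vectors the sum \<open>S \<eta>\<close> of the shifted
    path is constant, and the numerators add up to that same sum; what remains is at most the mean
    of \<open>f 0\<close>.\<close>
  have cell: "(\<integral>\<^sup>+ u. g (t - u) \<partial>?L) \<le> 1" for t
  proof -
    have "(\<integral>\<^sup>+ u. g (t - u) \<partial>?L) =
        (\<integral>\<^sup>+ f. (\<integral>\<^sup>+ u. ennreal (f 0) * ?F (shift_field (t - u) f) \<partial>?L) \<partial>P)"
      unfolding g_def by (rule PL.Fubini'[symmetric]) measurable
    also have "\<dots> \<le> (\<integral>\<^sup>+ f. ennreal (f 0) \<partial>P)"
    proof (rule nn_integral_mono)
      fix f assume "f \<in> space P"
      then have f: "f \<in> cadlag" by (simp add: space_P)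
      have [measurable]: "f \<in> borel_measurable borel" by (rule cadlag_borel_measurable) fact
      let ?s = "S \<eta> (shift_field t f)"
      have "(\<integral>\<^sup>+ u. ennreal (f 0) * ?F (shift_field (t - u) f) \<partial>?L) =
          (\<integral>\<^sup>+ u. ennreal (f 0) * inverse ?s * ennreal (shift_field t f u) \<partial>?L)"
      proof (rule nn_integral_cong)
        fix u assume "u \<in> space ?L"
        then have "u \<in> grid \<eta>" by (simp add: space_grid_measure)
        from S_shift_field[OF shift_field_cadlag[OF f] grid_minus[OF this], of t]
        have "S \<eta> (shift_field (t - u) f) = ?s" by (simp add: shift_shift)
        then show "ennreal (f 0) * ?F (shift_field (t - u) f) =
            ennreal (f 0) * inverse ?s * ennreal (shift_field t f u)"
          by (simp add: shift_field_def divide_ennreal_def mult_ac)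
      qed
      also have "\<dots> = ennreal (f 0) * inverse ?s * ?s"
        unfolding S_def[of \<eta>] by (rule nn_integral_cmult) (unfold shift_field_def, measurable)
      also have "\<dots> = ennreal (f 0) * (?s / ?s)"
        by (simp add: divide_ennreal_def mult_ac)
      \<comment> \<open>The quotient is \<open>0\<close> instead of \<open>1\<close> when the sum is
        zero or infinite, hence an inequality.\<close>
      also have "\<dots> \<le> ennreal (f 0) * 1"
        by (intro mult_left_mono) (cases "?s = 0 \<or> ?s = \<infinity>", auto simp: less_top)
      finally show "(\<integral>\<^sup>+ u. ennreal (f 0) * ?F (shift_field (t - u) f) \<partial>?L) \<le> ennreal (f 0)" by simp
    qed
    finally show ?thesis by (simp add: mean)
  qed
  have "?c * (\<integral>\<^sup>+ t. g t \<partial>lborel) = (\<integral>\<^sup>+ t. ?c * g t \<partial>lborel)"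
    by (rule nn_integral_cmult[symmetric]) (use g in simp)
  \<comment> \<open>Each \<open>t\<close> has a grid vector moving it into the cell, and the point
    mass of that vector is \<open>?c\<close>.\<close>
  also have "\<dots> \<le> (\<integral>\<^sup>+ t. (\<integral>\<^sup>+ u. g t * indicator (sqbox 0 \<eta>) (t + u) \<partial>?L) \<partial>lborel)"
  proof (rule nn_integral_mono)
    fix t :: "real ^ 'd"
    obtain u where u: "u \<in> grid \<eta>" "t + u \<in> sqbox 0 \<eta>" using grid_covering[OF \<eta>] by blast
    have s: "{u} \<in> sets ?L" using sets_grid_measure_Int[of "{u}" \<eta>] u by simp
    have "emeasure ?L {u} = ?c" using u \<eta> by (simp add: grid_measure_def)
    then have "?c * g t = (\<integral>\<^sup>+ v. g t * indicator {u} v \<partial>?L)"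
      by (subst nn_integral_cmult_indicator[OF s]) (simp add: mult.commute)
    also have "\<dots> \<le> (\<integral>\<^sup>+ u. g t * indicator (sqbox 0 \<eta>) (t + u) \<partial>?L)"
      using u by (intro nn_integral_mono mult_left_mono) (auto simp: indicator_def)
    finally show "?c * g t \<le> (\<integral>\<^sup>+ u. g t * indicator (sqbox 0 \<eta>) (t + u) \<partial>?L)" .
  qed
  also have "\<dots> = (\<integral>\<^sup>+ u. (\<integral>\<^sup>+ t. g t * indicator (sqbox 0 \<eta>) (t + u) \<partial>lborel) \<partial>?L)"
    by (rule LL.Fubini') measurable
  \<comment> \<open>Substituting \<open>t - u\<close> for \<open>t\<close> confines \<open>t\<close>
    to the cell, so that after another exchange the inner integral is the one bounded in
    \<open>cell\<close>.\<close>
  also have "\<dots> = (\<integral>\<^sup>+ u. (\<integral>\<^sup>+ t. g (t - u) * indicator (sqbox 0 \<eta>) t \<partial>lborel) \<partial>?L)"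
  proof (rule nn_integral_cong)
    fix u :: "real ^ 'd"
    show "(\<integral>\<^sup>+ t. g t * indicator (sqbox 0 \<eta>) (t + u) \<partial>lborel) =
        (\<integral>\<^sup>+ t. g (t - u) * indicator (sqbox 0 \<eta>) t \<partial>lborel)"
      using nn_integral_grid_measure_shift[of u 0 "\<lambda>t. g (t - u) * indicator (sqbox 0 \<eta>) t"]
      by (simp add: grid_def grid_measure_def)
  qed
  also have "\<dots> = (\<integral>\<^sup>+ t. (\<integral>\<^sup>+ u. g (t - u) * indicator (sqbox 0 \<eta>) t \<partial>?L) \<partial>lborel)"
    by (rule LL.Fubini'[symmetric]) measurable
  also have "\<dots> \<le> (\<integral>\<^sup>+ t. indicator (sqbox 0 \<eta>) t \<partial>(lborel :: (real ^ 'd) measure))"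
  proof (rule nn_integral_mono)
    fix t :: "real ^ 'd"
    show "(\<integral>\<^sup>+ u. g (t - u) * indicator (sqbox 0 \<eta>) t \<partial>?L) \<le> indicator (sqbox 0 \<eta>) t"
      using cell[of t] by (simp add: indicator_def)
  qed
  also have "\<dots> < \<infinity>" using emeasure_sqbox[of 0 \<eta>, where 'd='d] \<eta> by simp
  finally have "(\<integral>\<^sup>+ t. g t \<partial>lborel) \<noteq> \<infinity>"
    using \<eta> by (auto simp: ennreal_mult_top)
  then have "(\<integral>\<^sup>+ f. S 0 f * ?F f \<partial>P) \<noteq> \<infinity>" by (simp add: S)
  from nn_integral_PInf_AE[OF _ this] have "AE f in P. S 0 f * ?F f \<noteq> \<infinity>" by measurable
  then show ?thesis
  proof eventually_elim
    case (elim f)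
    show ?case
    proof
      assume "S 0 f = \<infinity>"
      then show "?F f = 0" using elim by (cases "?F f = 0") (simp_all add: ennreal_top_mult)
    qed
  qed
qed

end

section \<open>The limit of the full ratio, from the dissipative and the conservative part\<close>

context dissipative
begin

lemma Phi_UNIV: "Phi UNIV = (\<integral>\<^sup>+ f. ennreal (f 0) * (sup_on (grid \<delta>) f / S \<eta> f) \<partial>P)"
  unfolding Phi_def
proof (rule nn_integral_cong_AE)
  have "AE f in P. S 0 f = \<infinity> \<longrightarrow> ennreal (f 0) / S \<eta> f = 0"
    using conservative_grid[of \<eta>] eta by (cases "\<eta> = 0") auto
  then show "AE f in P. sup_on (UNIV \<inter> grid \<delta>) f * wt \<eta> f = ennreal (f 0) * (sup_on (grid \<delta>) f / S \<eta> f)"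
  proof eventually_elim
    case (elim f)
    have "ennreal (f 0) * (sup_on (grid \<delta>) f / S \<eta> f) = sup_on (grid \<delta>) f * (ennreal (f 0) / S \<eta> f)"
      by (simp add: divide_ennreal_def mult_ac)
    then show ?case
      using elim by (cases "S 0 f = \<infinity>") (auto simp: wt_def finite_ind_def less_top)
  qed
qed

text \<open>The conservative contribution over a grid is dominated by the one over the full cube,
  which is negligible, so only the dissipative limit remains.\<close>

lemma ratio_tendsto:
  "((\<lambda>T. (\<integral>\<^sup>+ f. sup_on (sqbox 0 T \<inter> grid \<delta>) f \<partial>P) / ennreal (T ^ CARD('d))) \<longlongrightarrow> Phi UNIV) at_top"
proof -
  define C where "C T = (\<integral>\<^sup>+ f. sup_on (sqbox 0 T \<inter> grid \<delta>) f * infinite_ind f \<partial>P)" for T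
  have "((\<lambda>T. C T / ennreal (T ^ CARD('d))) \<longlongrightarrow> 0) at_top"
  proof (rule tendsto_sandwich[OF _ _ tendsto_const conservative_tendsto])
    have "C T / ennreal (T ^ CARD('d)) \<le>
        (\<integral>\<^sup>+ f. sup_on (sqbox 0 T) f * infinite_ind f \<partial>P) / ennreal (T ^ CARD('d))" for T
      unfolding C_def by (intro divide_right_mono_ennreal nn_integral_mono mult_right_mono sup_on_mono) auto
    then show "\<forall>\<^sub>F T in at_top. C T / ennreal (T ^ CARD('d)) \<le>
        (\<integral>\<^sup>+ f. sup_on (sqbox 0 T) f * infinite_ind f \<partial>P) / ennreal (T ^ CARD('d))"
      by (intro always_eventually allI)
  qed auto
  from tendsto_add[OF E_ratio_tendsto this]
  have "((\<lambda>T. E T / ennreal (T ^ CARD('d)) + C T / ennreal (T ^ CARD('d))) \<longlongrightarrow> Phi UNIV) at_top"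
    by simp
  moreover have "(\<integral>\<^sup>+ f. sup_on (sqbox 0 T \<inter> grid \<delta>) f \<partial>P) = E T + C T" for T
  proof -
    have "(\<integral>\<^sup>+ f. sup_on (sqbox 0 T \<inter> grid \<delta>) f \<partial>P) =
        (\<integral>\<^sup>+ f. sup_on (sqbox 0 T \<inter> grid \<delta>) f * finite_ind f +
          sup_on (sqbox 0 T \<inter> grid \<delta>) f * infinite_ind f \<partial>P)"
      by (intro nn_integral_cong) (auto simp: finite_ind_def infinite_ind_def indicator_def less_top)
    also have "\<dots> = E T + C T"
      unfolding E_def C_def by (rule nn_integral_add) measurable
    finally show ?thesis .
  qed
  ultimately show ?thesis by (simp add: divide_ennreal_def distrib_right)
qed

end

subsection \<open>Passage to the law of the sample paths\<close>

lemma SUP_min_of_nat: "(SUP n::nat. min x (of_nat n)) = (x :: ennreal)"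
  using inf_SUP[of x "\<lambda>n::nat. of_nat n :: ennreal" UNIV]
  by (simp add: inf_min ennreal_SUP_of_nat_eq_top)

theorem proposition1:
  fixes M :: "'w measure" and Z :: "'w \<Rightarrow> real ^ 'd \<Rightarrow> real"
  assumes "prob_space M" and "complete_measure M"
    and "\<And>t. (\<lambda>\<omega>. Z \<omega> t) \<in> borel_measurable M"
    and "\<And>\<omega> t. \<omega> \<in> space M \<Longrightarrow> 0 \<le> Z \<omega> t"
    and "AE \<omega> in M. Z \<omega> \<in> cadlag"
    and a: "\<And>t. (\<integral>\<^sup>+ \<omega>. ennreal (Z \<omega> t) \<partial>M) = 1"
    and b: "\<And>T. T > 0 \<Longrightarrow>
      (\<integral>\<^sup>+ \<omega>. (SUP t\<in>cube T. ennreal (Z \<omega> t)) \<partial>M) \<in> {0<..<\<infinity>}"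
    and c: "\<And>h F. F \<in> borel_measurable cadlag_space \<Longrightarrow>
      (\<And>f. f \<in> cadlag \<Longrightarrow> 0 \<le> F f) \<Longrightarrow>
      (\<And>u f. u > 0 \<Longrightarrow> f \<in> cadlag \<Longrightarrow> F (\<lambda>t. u * f t) = F f) \<Longrightarrow>
      (\<integral>\<^sup>+ \<omega>. ennreal (Z \<omega> h * F (Z \<omega>)) \<partial>M) =
      (\<integral>\<^sup>+ \<omega>. ennreal (Z \<omega> 0 * F (shift_field h (Z \<omega>))) \<partial>M)"
    and d: "pickands_const M Z 0 > 0"
  shows "pickands_formula M Z 0 0 \<and>
    (\<forall>\<delta> \<eta>. (\<delta> = 0 \<and> \<eta> > 0) \<or> (\<delta> > 0 \<and> (\<exists>k::nat. k \<ge> 1 \<and> \<eta> = real k * \<delta>)) \<longrightarrow>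
      (\<forall>r\<in>grid \<delta>. AE \<omega> in M. S 0 (Z \<omega>) < \<infinity> \<longrightarrow> S \<eta> (shift_field r (Z \<omega>)) \<in> {0<..<\<infinity>}) \<longrightarrow>
      pickands_formula M Z \<delta> \<eta>)"
proof -
  interpret prob_space M by fact
  note Z_meas = assms(3) and Z_nonneg = assms(4)
  \<comment> \<open>\<open>N\<close> is a measurable null set containing the possibly non-measurable
    set of bad outcomes; changing the field on \<open>N\<close> gives a measurable map into
    \<open>cadlag_space\<close>.\<close>
  obtain N where N: "{\<omega> \<in> space M. Z \<omega> \<notin> cadlag} \<subseteq> N" "emeasure M N = 0" "N \<in> sets M"
    using assms(5) by (rule AE_E)
  define Y where "Y \<omega> = (if \<omega> \<in> space M - N then Z \<omega> else (\<lambda>_. 0))" for \<omega>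
  have Y [measurable]: "Y \<in> M \<rightarrow>\<^sub>M cadlag_space"
  proof (rule measurable_cadlag_spaceI)
    show "Y \<omega> \<in> cadlag" for \<omega> using N(1) by (auto simp: Y_def zero_cadlag)
    have "(\<lambda>\<omega>. if \<omega> \<in> space M - N then Z \<omega> t else 0) \<in> borel_measurable M" for t
      using Z_meas N(3) by (intro measurable_If_set) auto
    then show "(\<lambda>\<omega>. Y \<omega> t) \<in> borel_measurable M" for t
      by (simp add: Y_def if_distrib[of "\<lambda>f. f t"] cong: if_cong)
  qed
  have ae: "AE \<omega> in M. Y \<omega> = Z \<omega>"
    by (rule AE_I[OF _ N(2,3)]) (auto simp: Y_def)
  define P where "P = distr M cadlag_space Y"
  have integral_P: "(\<integral>\<^sup>+ f. \<phi> f \<partial>P) = (\<integral>\<^sup>+ \<omega>. \<phi> (Z \<omega>) \<partial>M)"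
    if "\<phi> \<in> borel_measurable cadlag_space" for \<phi> :: "(real ^ 'd \<Rightarrow> real) \<Rightarrow> ennreal"
  proof -
    have "(\<integral>\<^sup>+ f. \<phi> f \<partial>P) = (\<integral>\<^sup>+ \<omega>. \<phi> (Y \<omega>) \<partial>M)"
      unfolding P_def by (rule nn_integral_distr[OF Y]) (use that in simp)
    also have "\<dots> = (\<integral>\<^sup>+ \<omega>. \<phi> (Z \<omega>) \<partial>M)"
      by (rule nn_integral_cong_AE) (use ae in eventually_elim, simp)
    finally show ?thesis .
  qed
  interpret P: tilted_stationary P
  proof (intro tilted_stationary.intro tilted_stationary_axioms.intro)
    show "prob_space P" unfolding P_def by (rule prob_space_distr[OF Y])
    show "sets P = sets cadlag_space" by (simp add: P_def)
    have [measurable]: "(\<lambda>f. f t) \<in> borel_measurable cadlag_space" for t :: "real ^ 'd"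
      by (rule measurable_eval)
    show "(\<integral>\<^sup>+ f. ennreal (f t) \<partial>P) = 1" for t
      by (subst integral_P) (simp_all add: a)
    show "(\<integral>\<^sup>+ f. sup_on (sqbox 0 T) f \<partial>P) < \<infinity>" if "T > 0" for T
      using b[OF that] by (subst integral_P[OF measurable_sup_on_sqbox]) (simp add: sup_on_def cube_sqbox)
    show "(\<integral>\<^sup>+ f. ennreal (f h) * F f \<partial>P) = (\<integral>\<^sup>+ f. ennreal (f 0) * F (shift_field h f) \<partial>P)"
      if F [measurable]: "F \<in> borel_measurable cadlag_space"
        and hom: "\<And>u f. u > 0 \<Longrightarrow> f \<in> cadlag \<Longrightarrow> F (\<lambda>t. u * f t) = F f"
      for h :: "real ^ 'd" and F
    proof -
      have P_meas [measurable_cong]: "sets P = sets cadlag_space" by (simp add: P_def)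
      \<comment> \<open>The given tilting identity concerns real-valued functionals. It is applied
        to the truncations at \<open>n\<close>, and monotone convergence extends it to functionals
        with values in \<open>ennreal\<close>.\<close>
      have trunc: "(\<integral>\<^sup>+ f. ennreal (f t) * H f \<partial>P) =
          (SUP n::nat. \<integral>\<^sup>+ f. ennreal (f t) * min (H f) (of_nat n) \<partial>P)"
        if H [measurable]: "H \<in> borel_measurable cadlag_space" for t H
      proof -
        have "(\<integral>\<^sup>+ f. ennreal (f t) * H f \<partial>P) =
            (\<integral>\<^sup>+ f. (SUP n::nat. ennreal (f t) * min (H f) (of_nat n)) \<partial>P)"
          by (simp only: SUP_mult_left_ennreal[symmetric] SUP_min_of_nat)
        also have "\<dots> = (SUP n::nat. \<integral>\<^sup>+ f. ennreal (f t) * min (H f) (of_nat n) \<partial>P)"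
        proof (rule nn_integral_monotone_convergence_SUP)
          have "min (H f) (of_nat n) \<le> min (H f) (of_nat (Suc n))" for f n
            by (rule min.mono) simp_all
          then show "incseq (\<lambda>n f. ennreal (f t) * min (H f) (of_nat n))"
            by (intro incseq_SucI le_funI mult_left_mono) simp_all
        qed measurable
        finally show ?thesis .
      qed
      have real: "ennreal (x * enn2real (min y (of_nat n))) = ennreal x * min y (of_nat n)"
        if "x \<ge> 0" for x y and n :: nat
      proof -
        have "min y (of_nat n) < top" by (simp add: min_less_iff_disj of_nat_less_top)
        then show ?thesis using that by (simp add: ennreal_mult)
      qed
      have "(\<integral>\<^sup>+ f. ennreal (f h) * min (F f) (of_nat n) \<partial>P) =
          (\<integral>\<^sup>+ f. ennreal (f 0) * min (F (shift_field h f)) (of_nat n) \<partial>P)" for n :: nat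
      proof -
        have "(\<integral>\<^sup>+ f. ennreal (f h) * min (F f) (of_nat n) \<partial>P) =
            (\<integral>\<^sup>+ \<omega>. ennreal (Z \<omega> h) * min (F (Z \<omega>)) (of_nat n) \<partial>M)"
          by (rule integral_P) measurable
        also have "\<dots> = (\<integral>\<^sup>+ \<omega>. ennreal (Z \<omega> h * enn2real (min (F (Z \<omega>)) (of_nat n))) \<partial>M)"
          by (intro nn_integral_cong) (simp add: real Z_nonneg)
        also have "\<dots> = (\<integral>\<^sup>+ \<omega>. ennreal (Z \<omega> 0 * enn2real (min (F (shift_field h (Z \<omega>))) (of_nat n))) \<partial>M)"
          by (rule c) (use hom in auto)
        also have "\<dots> = (\<integral>\<^sup>+ \<omega>. ennreal (Z \<omega> 0) * min (F (shift_field h (Z \<omega>))) (of_nat n) \<partial>M)"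
          by (intro nn_integral_cong) (simp add: real Z_nonneg)
        also have "\<dots> = (\<integral>\<^sup>+ f. ennreal (f 0) * min (F (shift_field h f)) (of_nat n) \<partial>P)"
          by (rule integral_P[symmetric]) measurable
        finally show ?thesis .
      qed
      moreover have shift_F: "(\<lambda>f. F (shift_field h f)) \<in> borel_measurable cadlag_space"
        by measurable
      ultimately show ?thesis unfolding trunc[OF F] trunc[OF shift_F] by presburger
    qed
  qed
  \<comment> \<open>Membership in \<open>cadlag\<close> is a premise of \<open>side\<close> because
    a vanishing integral forces the supremum to vanish only for right-continuous paths.\<close>
  have formula: "pickands_formula M Z \<delta> \<eta>"
    if "\<eta> \<ge> 0" "(grid \<eta> :: (real ^ 'd) set) \<subseteq> grid \<delta>"
      and side: "AE \<omega> in M. S 0 (Z \<omega>) < \<infinity> \<longrightarrow> Z \<omega> \<in> cadlag \<longrightarrow>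
        S \<eta> (Z \<omega>) < \<infinity> \<and> (S \<eta> (Z \<omega>) = 0 \<longrightarrow> sup_on (grid \<delta>) (Z \<omega>) = 0)" for \<delta> \<eta>
  proof -
    interpret D: dissipative P \<delta> \<eta>
    proof
      note measurable_S [measurable] measurable_sup_on_grid [measurable]
      have "AE \<omega> in M. S 0 (Y \<omega>) < \<infinity> \<longrightarrow>
          S \<eta> (Y \<omega>) < \<infinity> \<and> (S \<eta> (Y \<omega>) = 0 \<longrightarrow> sup_on (grid \<delta>) (Y \<omega>) = 0)"
        using side ae assms(5) by eventually_elim simp
      then show "AE f in P. S 0 f < \<infinity> \<longrightarrow> S \<eta> f < \<infinity> \<and> (S \<eta> f = 0 \<longrightarrow> sup_on (grid \<delta>) f = 0)"
        unfolding P_def by (subst AE_distr_iff[OF Y]) measurable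
    qed (use that in auto)
    have "pickands_ratio M Z \<delta> T = (\<integral>\<^sup>+ f. sup_on (sqbox 0 T \<inter> grid \<delta>) f \<partial>P) / ennreal (T ^ CARD('d))" for T
      by (subst integral_P[OF measurable_sup_on_sqbox_grid]) (simp add: pickands_ratio_def sup_on_def cube_sqbox)
    then have lim: "(pickands_ratio M Z \<delta> \<longlongrightarrow> D.Phi UNIV) at_top"
      using D.ratio_tendsto by presburger
    then have const: "pickands_const M Z \<delta> = D.Phi UNIV"
      unfolding pickands_const_def by (intro tendsto_Lim) auto
    have "D.Phi UNIV = pickands_expectation M Z \<delta> \<eta>"
      unfolding D.Phi_UNIV pickands_expectation_def sup_on_def[symmetric]
    proof (rule integral_P)
      note measurable_S [measurable] measurable_sup_on_grid [measurable]
      show "(\<lambda>f. ennreal (f 0) * (sup_on (grid \<delta>) f / S \<eta> f)) \<in> borel_measurable cadlag_space"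
        using measurable_eval[of 0] by measurable
    qed
    then show ?thesis
      unfolding pickands_formula_def using lim const D.Phi_finite by simp
  qed
  show ?thesis
  proof (intro conjI allI impI)
    show "pickands_formula M Z 0 0"
      by (rule formula) (auto simp: S_eq_0_imp_sup_on_eq_0)
  next
    fix \<delta> \<eta> :: real
    assume cases: "\<delta> = 0 \<and> \<eta> > 0 \<or> \<delta> > 0 \<and> (\<exists>k::nat. k \<ge> 1 \<and> \<eta> = real k * \<delta>)"
      and side: "\<forall>r\<in>grid \<delta>. AE \<omega> in M. S 0 (Z \<omega>) < \<infinity> \<longrightarrow> S \<eta> (shift_field r (Z \<omega>)) \<in> {0<..<\<infinity>}"
    show "pickands_formula M Z \<delta> \<eta>"
    proof (rule formula)
      show "\<eta> \<ge> 0" using cases by auto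
      show "(grid \<eta> :: (real ^ 'd) set) \<subseteq> grid \<delta>"
      proof (cases "\<delta> = 0")
        case True
        then show ?thesis by (simp add: grid_def)
      next
        case False
        then obtain k :: nat where "k \<ge> 1" "\<eta> = real k * \<delta>" using cases by blast
        then show ?thesis using grid_multiple by blast
      qed
      \<comment> \<open>This is the assumed inclusion at \<open>r = 0\<close>; strict positivity
        makes the case of a zero sum vacuous.\<close>
      have "AE \<omega> in M. S 0 (Z \<omega>) < \<infinity> \<longrightarrow> S \<eta> (Z \<omega>) \<in> {0<..<\<infinity>}"
        using bspec[OF side zero_in_grid] by (simp add: shift_zero)
      then show "AE \<omega> in M. S 0 (Z \<omega>) < \<infinity> \<longrightarrow> Z \<omega> \<in> cadlag \<longrightarrow>
          S \<eta> (Z \<omega>) < \<infinity> \<and> (S \<eta> (Z \<omega>) = 0 \<longrightarrow> sup_on (grid \<delta>) (Z \<omega>) = 0)"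
        by eventually_elim auto
    qed
  qed
qed

end
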